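(* Let $|q|<1$ and define integers $h_1(n)$ ($n\ge 0$) by $$(-q^{2},-q^{3};q^{5})_{\infty}^{2}(q^{2},q^{8};q^{10})_{\infty}=\sum_{n=0}^{\infty}h_{1}(n)q^{n}.$$ Then $$(-q^{2},-q^{3};q^{5})_{\infty}^{2}(q^{2},q^{8};q^{10})_{\infty}=H_{0}(q^{5})+q^{2}H_{2}(q^{5})+q^{3}H_{3}(q^{5})+q^{4}H_{4}(q^{5}),$$ where \begin{align*} H_{0}(q) &=\sum_{n=0}^{\infty}h_{1}(5n)q^{n}=\frac{1}{(q,q^{4};q^{5})_{\infty}^{2}(q^{2},q^{8};q^{10})_{\infty}},\\ H_{2}(q) &=\sum_{n=0}^{\infty}h_{1}(5n+2)q^{n}=\frac{1}{(q^{2},q^{3};q^{5})_{\infty}^{2}(q^{2},q^{8};q^{10})_{\infty}},\\ H_{3}(q) &=\sum_{n=0}^{\infty}h_{1}(5n+3)q^{n}=\frac{2}{(q,q^{2},q^{3},q^{4};q^{5})_{\infty}(q^{4},q^{6};q^{10})_{\infty}},\\ H_{4}(q) &=\sum_{n=0}^{\infty}h_{1}(5n+4)q^{n}=\frac{-1}{(q^{2},q^{3};q^{5})_{\infty}^{2}(q^{4},q^{6};q^{10})_{\infty}}. \end{align*}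
   Context: Notation: for $|q|<1$, $(a;q)_{\infty}:=\prod_{n=0}^{\infty}(1-aq^{n})$ and $(a_{1},\ldots,a_{m};q)_{\infty}:=(a_{1};q)_{\infty}\cdots(a_{m};q)_{\infty}$; similarly with $q$ replaced by $q^k$ in the base. *)

theory Defs
  imports "HOL-Analysis.Analysis"
begin

text \<open>The infinite \<open>q\<close>-Pochhammer symbol \<open>(a; q)\<^sub>\<infinity>\<close>; meaningful for \<open>norm q < 1\<close>.\<close>

definition qpoch_inf :: "complex \<Rightarrow> complex \<Rightarrow> complex" where
  "qpoch_inf a q = (\<Prod>n. 1 - a * q ^ n)"

text \<open>The multi-parameter symbol \<open>(a\<^sub>1, \<dots>, a\<^sub>m; q)\<^sub>\<infinity>\<close>.\<close>

definition qpochs_inf :: "complex list \<Rightarrow> complex \<Rightarrow> complex" where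
  "qpochs_inf as q = (\<Prod>a\<leftarrow>as. qpoch_inf a q)"

definition G1 :: "complex \<Rightarrow> complex" where
  "G1 q = (qpochs_inf [- (q ^ 2), - (q ^ 3)] (q ^ 5))\<^sup>2 * qpochs_inf [q ^ 2, q ^ 8] (q ^ 10)"

text \<open>The integers \<open>h\<^sub>1(n)\<close> are determined by the power series expansion of \<open>G1\<close> on the whole
  open unit disc. The description operator is only informative if such a sequence exists (it is
  then unique), so statements about \<open>h1\<close> should include the expansion itself.\<close>

definition h1 :: "nat \<Rightarrow> int" where
  "h1 = (THE h. \<forall>q::complex. norm q < 1 \<longrightarrow> (\<lambda>n. of_int (h n) * q ^ n) sums G1 q)"

definition H :: "nat \<Rightarrow> complex \<Rightarrow> complex" where
  "H r q = (\<Sum>n. of_int (h1 (5 * n + r)) * q ^ n)"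

end

theory Submission
  imports Defs "HOL-Complex_Analysis.Complex_Analysis" "HOL-Library.Nat_Bijection"
begin

text \<open>
  Put \<open>\<theta>\<^sub>r(x) = \<Sum>n\<in>\<int>. r\<^bsup>n\<^sup>2\<^esup> x\<^bsup>n\<^esup>\<close>. By the Jacobi triple product the infinite products in the
  theorem are, up to factors \<open>(q\<^sup>k; q\<^sup>k)\<^sub>\<infinity>\<close>, products of such series. In particular, with
  \<open>q = p\<^sup>2\<close>, multiplying \<open>G1 q\<close> by \<open>(q\<^sup>5; q\<^sup>5)\<^sub>\<infinity>\<^sup>2 (q\<^sup>1\<^sup>0; q\<^sup>1\<^sup>0)\<^sub>\<infinity>\<close>, which is a function of
  \<open>q\<^sup>5\<close> and so does not disturb residue classes of exponents modulo 5, gives \<open>\<theta>(p)\<^sup>2\<close> to base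
  \<open>p\<^sup>5\<close> times \<open>\<theta>(- q\<^sup>3)\<close> to base \<open>q\<^sup>5\<close>: a sum over \<open>\<int>\<^sup>3\<close>.

  This sum is dissected by two linear substitutions. Passing from \<open>(m, n)\<close> to \<open>(m + n, m - n)\<close>
  writes a product of two theta series as a sum of two products to the squared base
  (\<open>theta_parity_split\<close>). Multiplication by \<open>2 + \<i>\<close> on the Gaussian integers, whose image has
  index five and which multiplies \<open>m\<^sup>2 + n\<^sup>2\<close> by 5, writes it as a sum of five products to the
  fifth power of the base (\<open>theta_five_dissection\<close>), one for each coset of the image. The class
  of exponents \<open>1 mod 5\<close> carries the factor \<open>\<theta>\<^sub>r(- r) = 0\<close>; in each of the other classes a
  difference of two products of theta series, times a common theta series, remains.

  Each of these differences is a single product (\<open>theta_square_identities\<close>). After common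
  factors are removed by the triple product, these are instances of Weierstrass' three-term
  relation. They become polynomial identities once the parity split has expressed all pairwise
  products of theta values bilinearly in six numbers (\<open>theta_level5_relations\<close>).

  This proves the dissection of \<open>G1\<close> as an identity between functions (\<open>G1_dissection\<close>). All the
  functions involved are holomorphic in the unit disc, so power series coefficients may be
  compared. The coefficients of \<open>G1\<close> are integers, because they are limits of the coefficients
  of the partial products; hence \<open>h1\<close> is the sequence it is meant to be.
\<close>

section \<open>Sums over the integers\<close>

text \<open>
  Dominated convergence for sums over \<open>\<int>\<close>: Tannery's theorem for series, transported along an
  enumeration of the integers.
\<close>

lemma tendsto_infsum_dominated_int:
  fixes f :: "nat \<Rightarrow> int \<Rightarrow> complex"
  assumes lim: "\<And>j. (\<lambda>n. f n j) \<longlonglongrightarrow> g j"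
    and bound: "\<And>n j. norm (f n j) \<le> M j"
    and M: "M summable_on UNIV"
  shows "(\<lambda>n. infsum (f n) UNIV) \<longlonglongrightarrow> infsum g UNIV"
proof -
  have bij: "bij_betw int_decode UNIV UNIV"
    using bij_int_decode by simp
  have infsum_decode: "infsum h UNIV = (\<Sum>k. h (int_decode k))"
    if "\<And>j. norm (h j) \<le> M j" for h :: "int \<Rightarrow> complex"
  proof -
    have "(\<lambda>j. norm (h j)) summable_on UNIV"
      using M that by (rule summable_on_comparison_test) auto
    hence "h summable_on UNIV"
      by (rule Infinite_Sum.abs_summable_summable)
    hence "(h has_sum infsum h UNIV) UNIV"
      by simp
    hence "((\<lambda>k. h (int_decode k)) has_sum infsum h UNIV) UNIV"
      using has_sum_reindex_bij_betw[OF bij, of h] by simp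
    thus ?thesis
      using has_sum_imp_sums sums_unique by blast
  qed
  have bound_g: "norm (g j) \<le> M j" for j
    using lim[of j] bound by (intro LIMSEQ_le_const2[OF tendsto_norm]) auto
  have "(\<lambda>k. M (int_decode k)) summable_on UNIV"
    using M summable_on_reindex_bij_betw[OF bij, of M] by simp
  hence "summable (\<lambda>k. M (int_decode k))"
    by (rule summable_on_imp_summable)
  hence "(\<lambda>n. \<Sum>k. f n (int_decode k)) \<longlonglongrightarrow> (\<Sum>k. g (int_decode k))"
    using tannerys_theorem[of "\<lambda>k n. f n (int_decode k)" "\<lambda>k. g (int_decode k)" sequentially
        "\<lambda>k. M (int_decode k)"] lim bound by (auto simp: case_prod_unfold)
  thus ?thesis
    using infsum_decode bound bound_g by simp
qed

lemma has_sum_product: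
  fixes f :: "'a \<Rightarrow> complex" and g :: "'b \<Rightarrow> complex"
  assumes f: "(\<lambda>x. norm (f x)) summable_on A" and g: "(\<lambda>y. norm (g y)) summable_on B"
  shows "((\<lambda>(x, y). f x * g y) has_sum (infsum f A * infsum g B)) (A \<times> B)"
proof (rule has_sum_SigmaI)
  have "(\<lambda>z. norm (case z of (x, y) \<Rightarrow> f x * g y)) summable_on (A \<times> B)"
    unfolding Infinite_Sum.abs_summable_on_Sigma_iff
    using f g
    by (auto simp: norm_mult infsum_cmult_right' abs_mult infsum_nonneg
        intro!: summable_on_cmult_right summable_on_cmult_left)
  thus "(\<lambda>(x, y). f x * g y) summable_on A \<times> B"
    by (rule Infinite_Sum.abs_summable_summable)
  show "((\<lambda>y. case (x, y) of (x, y) \<Rightarrow> f x * g y) has_sum f x * infsum g B) B" for x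
    using Infinite_Sum.abs_summable_summable[OF g] by (auto intro!: has_sum_cmult_right)
  show "((\<lambda>x. f x * infsum g B) has_sum infsum f A * infsum g B) A"
    using Infinite_Sum.abs_summable_summable[OF f] by (auto intro!: has_sum_cmult_left)
qed

text \<open>
  In the two-parameter notation of Ramanujan, \<open>theta r x\<close> is \<open>f(r x, r / x)\<close>; in particular
  \<open>theta r 1\<close> is \<open>\<phi>(r)\<close> and \<open>theta r r\<close> is \<open>2 \<psi>(r\<^sup>2)\<close>. Integer powers are used so that the terms
  can be reindexed freely over \<open>\<int>\<close>.
\<close>

definition theta_term :: "complex \<Rightarrow> complex \<Rightarrow> int \<Rightarrow> complex" where
  "theta_term r x n = r powi (n * n) * x powi n"

definition theta :: "complex \<Rightarrow> complex \<Rightarrow> complex" where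
  "theta r x = (\<Sum>\<^sub>\<infinity>n. theta_term r x n)"

lemma summable_theta_nat:
  fixes r x :: complex
  assumes "norm r < 1"
  shows "summable (\<lambda>n. norm (r ^ (n * n) * x ^ n))"
proof -
  have "(\<lambda>n. norm r ^ n * norm x) \<longlonglongrightarrow> 0 * norm x"
    by (intro tendsto_intros LIMSEQ_power_zero) (use assms in auto)
  hence "\<forall>\<^sub>F n in sequentially. norm r ^ n * norm x < 1 / 2"
    by (intro order_tendstoD) auto
  then obtain N where N: "\<And>n. n \<ge> N \<Longrightarrow> norm r ^ n * norm x < 1 / 2"
    by (auto simp: eventually_at_top_linorder)
  show ?thesis
  proof (rule summable_ratio_test[of "1/2"])
    fix n assume n: "N \<le> n"
    have "norm (norm (r ^ (Suc n * Suc n) * x ^ Suc n)) =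
          (norm r ^ (n + Suc n) * norm x) * norm (norm (r ^ (n * n) * x ^ n))"
      by (simp add: norm_mult norm_power power_add)
    also have "\<dots> \<le> (1 / 2) * norm (norm (r ^ (n * n) * x ^ n))"
      using N[of "n + Suc n"] n by (intro mult_right_mono) auto
    finally show "norm (norm (r ^ (Suc n * Suc n) * x ^ Suc n))
      \<le> 1 / 2 * norm (norm (r ^ (n * n) * x ^ n))" .
  qed simp
qed

lemma theta_term_abs_summable:
  assumes "norm r < 1"
  shows "(\<lambda>n. norm (theta_term r x n)) summable_on UNIV"
proof -
  have pos: "(\<lambda>n. norm (theta_term r x n)) summable_on range int"
    by (subst summable_on_reindex)
       (auto simp: o_def theta_term_def simp
         flip: of_nat_mult intro!: norm_summable_imp_summable_on summable_theta_nat assms)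
  have neg: "(\<lambda>n. norm (theta_term r x n)) summable_on range (\<lambda>n. - int n)"
  proof (subst summable_on_reindex)
    show "inj (\<lambda>n. - int n)" by (auto simp: inj_on_def)
    have eq: "theta_term r x (- int n) = r ^ (n * n) * inverse x ^ n" for n
      by (simp add: theta_term_def power_int_minus power_inverse flip: of_nat_mult)
    show "(\<lambda>n. norm (theta_term r x n)) \<circ> (\<lambda>n. - int n) summable_on UNIV"
      unfolding o_def eq using summable_theta_nat[OF assms, of "inverse x"]
      by (intro norm_summable_imp_summable_on) simp
  qed
  have "(UNIV :: int set) = range int \<union> range (\<lambda>n. - int n)"
    by (auto simp: image_iff) (metis int_cases2)
  thus ?thesis
    using summable_on_union[OF pos neg] by simp
qed

lemma theta_mult_has_sum:
  assumes "norm r < 1"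
  shows "((\<lambda>(m, n). theta_term r x m * theta_term r y n) has_sum theta r x * theta r y) UNIV"
  using has_sum_product[OF theta_term_abs_summable[OF assms] theta_term_abs_summable[OF assms]]
  unfolding theta_def by simp

lemma theta_inverse: "theta r (inverse x) = theta r x"
  unfolding theta_def
  by (rule infsum_reindex_bij_witness[of _ uminus uminus])
     (auto simp: theta_term_def power_int_minus power_int_inverse)

text \<open>
  Shifting the summation index by one completes a square: \<open>n\<^sup>2 = (n - 1)\<^sup>2 + 2(n - 1) + 1\<close>.
\<close>

lemma theta_quasiperiod:
  assumes "r \<noteq> 0" "x \<noteq> 0"
  shows "theta r (r\<^sup>2 * x) = theta r x / (r * x)"
proof -
  have "theta r x = (\<Sum>\<^sub>\<infinity>n. (r * x) * theta_term r (r\<^sup>2 * x) n)"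
    unfolding theta_def
  proof (rule infsum_reindex_bij_witness[of _ "\<lambda>n. n + 1" "\<lambda>n. n - 1"])
    fix n :: int
    have "(r * x) * theta_term r (r\<^sup>2 * x) (n - 1) =
      (r * r powi ((n-1)*(n-1)) * (r powi 2) powi (n-1)) * (x * x powi (n - 1))"
      by (simp add: theta_term_def power_int_mult_distrib)
    also have "r * r powi ((n-1)*(n-1)) * (r powi 2) powi (n-1) = r powi (1 + (n-1)*(n-1) + 2 * (n-1))"
      using assms by (simp only: power_int_add power_int_mult power_int_1_right simp_thms mult.assoc)
    also have "1 + (n-1)*(n-1) + 2 * (n-1) = n * n"
      by (simp add: algebra_simps)
    also have "x * x powi (n - 1) = x powi n"
      using power_int_minus_mult[of x n] assms by (simp add: mult.commute)
    finally show "(r * x) * theta_term r (r\<^sup>2 * x) (n - 1) = theta_term r x n"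
      by (simp add: theta_term_def)
  qed auto
  also have "\<dots> = (r * x) * theta r (r\<^sup>2 * x)"
    by (simp add: theta_def infsum_cmult_right')
  finally show ?thesis
    using assms by simp
qed

section \<open>The infinite Pochhammer symbol\<close>

lemma convergent_prod_qpoch:
  assumes "norm q < 1"
  shows "convergent_prod (\<lambda>n. 1 - a * q ^ n :: complex)"
proof -
  have "summable (\<lambda>n. norm a * norm q ^ n)"
    using assms by (intro summable_mult summable_geometric) auto
  hence "summable (\<lambda>n. norm ((1 - a * q ^ n) - 1))"
    by (simp add: norm_mult norm_power)
  thus ?thesis
    by (intro abs_convergent_prod_imp_convergent_prod summable_imp_abs_convergent_prod)
qed

lemma qpoch_inf_tendsto:
  assumes "norm q < 1"
  shows "(\<lambda>N. \<Prod>n<N. 1 - a * q ^ n) \<longlonglongrightarrow> qpoch_inf a q"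
proof -
  have "(\<lambda>N. \<Prod>n<Suc N. 1 - a * q ^ n) \<longlonglongrightarrow> qpoch_inf a q"
    using convergent_prod_LIMSEQ[OF convergent_prod_qpoch[OF assms, of a]]
    by (simp add: qpoch_inf_def lessThan_Suc_atMost)
  thus ?thesis
    by (rule LIMSEQ_imp_Suc)
qed

lemma qpoch_inf_nonzero:
  assumes "norm q < 1" "norm a < 1"
  shows "qpoch_inf a q \<noteq> 0"
  unfolding qpoch_inf_def
proof (rule prodinf_nonzero[OF convergent_prod_qpoch[OF assms(1)]])
  fix n
  have "norm (a * q ^ n) \<le> norm a * 1"
    unfolding norm_mult norm_power using assms by (intro mult_left_mono power_le_one) auto
  thus "1 - a * q ^ n \<noteq> 0"
    using assms by auto
qed

lemma qpoch_inf_one_eq_0: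
  assumes "norm q < 1"
  shows "qpoch_inf 1 q = 0"
proof -
  have "(\<lambda>N. \<Prod>n<Suc N. 1 - 1 * q ^ n) \<longlonglongrightarrow> qpoch_inf 1 q"
    by (rule LIMSEQ_Suc[OF qpoch_inf_tendsto[OF assms]])
  hence "(\<lambda>_. 0) \<longlonglongrightarrow> qpoch_inf 1 q"
    by (simp add: prod.lessThan_Suc_shift del: prod.lessThan_Suc)
  thus ?thesis
    by (simp add: LIMSEQ_const_iff)
qed

text \<open>
  The factors are sorted by the residue of their index modulo \<open>k\<close>.
\<close>

lemma qpoch_inf_split:
  assumes q: "norm q < 1" and k: "k > 0"
  shows "qpoch_inf a q = (\<Prod>j<k. qpoch_inf (a * q ^ j) (q ^ k))"
proof (rule LIMSEQ_unique)
  have "(\<lambda>M. \<Prod>n<M * k. 1 - a * q ^ n) \<longlonglongrightarrow> qpoch_inf a q"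
    using LIMSEQ_subseq_LIMSEQ[OF qpoch_inf_tendsto[OF q, of a], of "\<lambda>M. M * k"] k
    by (simp add: strict_mono_def o_def)
  also have "(\<lambda>M. \<Prod>n<M * k. 1 - a * q ^ n) = (\<lambda>M. \<Prod>j<k. \<Prod>n<M. 1 - (a * q ^ j) * (q ^ k) ^ n)"
  proof
    fix M
    have "(\<Prod>n<M * k. 1 - a * q ^ n) = (\<Prod>n<M. \<Prod>i\<in>{n * k..<n * k + k}. 1 - a * q ^ i)"
      by (rule prod.nat_group[symmetric])
    also have "\<dots> = (\<Prod>n<M. \<Prod>j<k. 1 - (a * q ^ j) * (q ^ k) ^ n)"
    proof (rule prod.cong[OF refl])
      fix n
      show "(\<Prod>i\<in>{n * k..<n * k + k}. 1 - a * q ^ i) = (\<Prod>j<k. 1 - (a * q ^ j) * (q ^ k) ^ n)"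
        by (rule prod.reindex_bij_witness[of _ "\<lambda>j. n * k + j" "\<lambda>i. i - n * k"])
           (auto simp: mult_ac simp flip: power_mult power_add)
    qed
    also have "\<dots> = (\<Prod>j<k. \<Prod>n<M. 1 - (a * q ^ j) * (q ^ k) ^ n)"
      by (rule prod.swap)
    finally show "(\<Prod>n<M * k. 1 - a * q ^ n) = (\<Prod>j<k. \<Prod>n<M. 1 - (a * q ^ j) * (q ^ k) ^ n)" .
  qed
  finally show "(\<lambda>M. \<Prod>j<k. \<Prod>n<M. 1 - (a * q ^ j) * (q ^ k) ^ n) \<longlonglongrightarrow> qpoch_inf a q" .
  show "(\<lambda>M. \<Prod>j<k. \<Prod>n<M. 1 - (a * q ^ j) * (q ^ k) ^ n) \<longlonglongrightarrow> (\<Prod>j<k. qpoch_inf (a * q ^ j) (q ^ k))"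
    using q k by (intro tendsto_prod qpoch_inf_tendsto) (simp add: norm_power power_less_one_iff)
qed

lemma qpoch_inf_mult_uminus:
  assumes "norm q < 1"
  shows "qpoch_inf a q * qpoch_inf (- a) q = qpoch_inf (a\<^sup>2) (q\<^sup>2)"
proof -
  have "(1 - a * q ^ n) * (1 - (- a) * q ^ n) = 1 - a\<^sup>2 * (q\<^sup>2) ^ n" for n
    by (simp add: algebra_simps power2_eq_square power_mult_distrib)
  thus ?thesis
    unfolding qpoch_inf_def
    using prodinf_mult[OF convergent_prod_qpoch[OF assms, of a] convergent_prod_qpoch[OF assms, of
      "- a"]]
    by simp
qed

lemma qpoch_inf_head:
  assumes "norm q < 1"
  shows "qpoch_inf a q = (1 - a) * qpoch_inf (a * q) q"
proof (rule LIMSEQ_unique)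
  show "(\<lambda>N. \<Prod>n<Suc N. 1 - a * q ^ n) \<longlonglongrightarrow> qpoch_inf a q"
    by (rule LIMSEQ_Suc[OF qpoch_inf_tendsto[OF assms]])
  have "(\<lambda>N. (1 - a) * (\<Prod>n<N. 1 - (a * q) * q ^ n)) \<longlonglongrightarrow> (1 - a) * qpoch_inf (a * q) q"
    by (intro tendsto_intros qpoch_inf_tendsto assms)
  thus "(\<lambda>N. \<Prod>n<Suc N. 1 - a * q ^ n) \<longlonglongrightarrow> (1 - a) * qpoch_inf (a * q) q"
    by (simp add: prod.lessThan_Suc_shift mult.assoc del: prod.lessThan_Suc)
qed

section \<open>The Jacobi triple product\<close>

text \<open>
  The triple product is obtained as the limit of a finite version, which in turn is the
  \<open>q\<close>-binomial theorem recentred at its middle term. Defining the Gaussian binomials by their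
  Pascal rule makes that theorem a direct induction; the quotient formula \<open>qbinom_qfact\<close> is what
  controls their size and their limit.
\<close>

fun qbinom :: "complex \<Rightarrow> nat \<Rightarrow> nat \<Rightarrow> complex" where
  "qbinom s M 0 = 1"
| "qbinom s 0 (Suc k) = 0"
| "qbinom s (Suc M) (Suc k) = qbinom s M (Suc k) + s ^ (M - k) * qbinom s M k"

lemma qbinom_eq_0: "M < k \<Longrightarrow> qbinom s M k = 0"
  by (induction s M k rule: qbinom.induct) auto

definition qfact :: "complex \<Rightarrow> nat \<Rightarrow> complex" where
  "qfact s n = (\<Prod>i<n. 1 - s ^ Suc i)"

lemma qfact_simps [simp]: "qfact s 0 = 1" "qfact s (Suc n) = qfact s n * (1 - s ^ Suc n)"
  by (simp_all add: qfact_def)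

lemma qbinom_qfact:
  "k \<le> M \<Longrightarrow> qbinom s M k * qfact s k * qfact s (M - k) = qfact s M"
proof (induction s M k rule: qbinom.induct)
  case (3 s M k)
  show ?case
  proof (cases "k = M")
    case True
    hence "(qbinom s M k * qfact s k * qfact s (M - k)) * (1 - s ^ Suc k) = qfact s M * (1 - s ^ Suc k)"
      using 3 by simp
    thus ?thesis
      using True by (simp add: qbinom_eq_0 mult.assoc del: mult_cancel_right)
  next
    case False
    then obtain d where d: "M = Suc (k + d)"
      using 3(3) by (metis Suc_le_mono le_neq_implies_less less_imp_Suc_add)
    have A: "qbinom s M (Suc k) * qfact s (Suc k) * qfact s d = qfact s M"
      and B: "qbinom s M k * qfact s k * qfact s (Suc d) = qfact s M"
      using 3 d by auto
    have "qbinom s (Suc M) (Suc k) * qfact s (Suc k) * qfact s (Suc M - Suc k) =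
          (qbinom s M (Suc k) * qfact s (Suc k) * qfact s d) * (1 - s ^ Suc d) +
          s ^ Suc d * (1 - s ^ Suc k) * (qbinom s M k * qfact s k * qfact s (Suc d))"
      by (simp add: d algebra_simps)
    also have "\<dots> = qfact s M * (1 - s ^ Suc M)"
      unfolding A B by (simp add: d algebra_simps power_add)
    finally show ?thesis by simp
  qed
qed auto

lemma qbinom_theorem:
  "(\<Prod>k<M. 1 + z * s ^ k) = (\<Sum>k\<le>M. qbinom s M k * s ^ (k * (k - 1) div 2) * z ^ k)"
proof (induction M)
  case (Suc M)
  have tri: "Suc k * (Suc k - 1) div 2 = k * (k - 1) div 2 + k" for k
    by (cases k) (auto simp: algebra_simps)
  have step: "s ^ (Suc k * (Suc k - 1) div 2) * s ^ (M - k) = s ^ M * s ^ (k * (k - 1) div 2)"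
    if "k \<le> M" for k
  proof -
    have "s ^ (k * (k - 1) div 2 + k) * s ^ (M - k) = s ^ (k * (k - 1) div 2) * (s ^ k * s ^ (M - k))"
      by (simp only: power_add mult.assoc)
    also have "s ^ k * s ^ (M - k) = s ^ M"
      using that by (simp flip: power_add)
    finally show ?thesis unfolding tri by (simp add: mult.commute)
  qed
  have "(\<Sum>k\<le>Suc M. qbinom s (Suc M) k * s ^ (k * (k - 1) div 2) * z ^ k) = 1 +
        (\<Sum>k\<le>M. qbinom s (Suc M) (Suc k) * s ^ (Suc k * (Suc k - 1) div 2) * z ^ Suc k)"
    by (subst sum.atMost_Suc_shift) simp
  also have "(\<Sum>k\<le>M. qbinom s (Suc M) (Suc k) * s ^ (Suc k * (Suc k - 1) div 2) * z ^ Suc k) =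
     (\<Sum>k\<le>M. qbinom s M (Suc k) * s ^ (Suc k * (Suc k - 1) div 2) * z ^ Suc k) +
     (\<Sum>k\<le>M. qbinom s M k * (s ^ (Suc k * (Suc k - 1) div 2) * s ^ (M - k)) * z ^ Suc k)"
    unfolding sum.distrib[symmetric] qbinom.simps by (intro sum.cong refl) (simp only: algebra_simps)
  also have "(\<Sum>k\<le>M. qbinom s M k * (s ^ (Suc k * (Suc k - 1) div 2) * s ^ (M - k)) * z ^ Suc k) =
    z * s ^ M * (\<Sum>k\<le>M. qbinom s M k * s ^ (k * (k - 1) div 2) * z ^ k)"
    unfolding sum_distrib_left by (intro sum.cong refl) (use step in \<open>simp add: mult_ac del: diff_Suc_1\<close>)
  also have "1 + ((\<Sum>k\<le>M. qbinom s M (Suc k) * s ^ (Suc k * (Suc k - 1) div 2) * z ^ Suc k) + \<dots>) =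
     (\<Sum>k\<le>Suc M. qbinom s M k * s ^ (k * (k - 1) div 2) * z ^ k) + \<dots>"
    unfolding sum.atMost_Suc_shift[of "\<lambda>k. qbinom s M k * s ^ (k * (k - 1) div 2) * z ^ k" M]
    by simp
  also have "(\<Sum>k\<le>Suc M. qbinom s M k * s ^ (k * (k - 1) div 2) * z ^ k) =
     (\<Sum>k\<le>M. qbinom s M k * s ^ (k * (k - 1) div 2) * z ^ k)"
    by (simp add: qbinom_eq_0)
  finally show ?case
    using Suc by (simp add: algebra_simps)
qed auto

text \<open>
  This is the \<open>q\<close>-binomial theorem to base \<open>r\<^sup>2\<close> with \<open>2 N\<close> factors at \<open>z = x r\<^bsup>1 - 2 N\<^esup>\<close>. The
  first \<open>N\<close> factors then involve negative powers of \<open>r\<close>; pulling \<open>x\<close> and these powers out of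
  them turns \<open>1 + x / r\<^bsup>2 k + 1\<^esup>\<close> into \<open>1 + r\<^bsup>2 k + 1\<^esup> / x\<close>.
\<close>

lemma finite_jacobi_triple_product:
  fixes r x :: complex
  assumes "r \<noteq> 0" "x \<noteq> 0"
  shows "(\<Prod>k<N. (1 + x * r ^ (2 * k + 1)) * (1 + r ^ (2 * k + 1) / x)) =
         (\<Sum>k\<le>2 * N. qbinom (r\<^sup>2) (2 * N) k * theta_term r x (int k - int N))"
proof -
  define z where "z = x * r powi (1 - 2 * int N)"
  have zk: "z * (r\<^sup>2) ^ k = x * r powi (2 * int k + 1 - 2 * int N)" for k
  proof -
    have "(r\<^sup>2) ^ k = r powi int (2 * k)"
      unfolding power_int_of_nat by (rule power_mult [symmetric])
    hence "z * (r\<^sup>2) ^ k = x * (r powi (1 - 2 * int N) * r powi int (2 * k))"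
      by (simp only: z_def mult.assoc)
    also have "\<dots> = x * r powi ((1 - 2 * int N) + int (2 * k))"
      using assms by (simp only: power_int_add simp_thms)
    also have "(1 - 2 * int N) + int (2 * k) = 2 * int k + 1 - 2 * int N"
      by simp
    finally show ?thesis .
  qed
  have "(\<Prod>k<2 * N. 1 + z * (r\<^sup>2) ^ k) = (\<Prod>k<N. 1 + z * (r\<^sup>2) ^ k) * (\<Prod>k<N. 1 + z * (r\<^sup>2) ^ (N + k))"
    using prod.nat_group[of "\<lambda>k. 1 + z * (r\<^sup>2) ^ k" N 2]
      prod.atLeastLessThan_concat[of 0 N "2 * N" "\<lambda>k. 1 + z * (r\<^sup>2) ^ k"]
      prod.shift_bounds_nat_ivl[of "\<lambda>k. 1 + z * (r\<^sup>2) ^ k" 0 N N]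
    by (simp add: lessThan_atLeast0 mult_2 add.commute)
  also have "(\<Prod>k<N. 1 + z * (r\<^sup>2) ^ (N + k)) = (\<Prod>k<N. 1 + x * r ^ (2 * k + 1))"
  proof (intro prod.cong refl)
    fix k
    have "2 * int (N + k) + 1 - 2 * int N = int (2 * k + 1)" by simp
    thus "1 + z * (r\<^sup>2) ^ (N + k) = 1 + x * r ^ (2 * k + 1)"
      unfolding zk by (simp only: power_int_of_nat)
  qed
  also have "(\<Prod>k<N. 1 + z * (r\<^sup>2) ^ k) = (\<Prod>k<N. 1 + z * (r\<^sup>2) ^ (N - Suc k))"
    by (rule prod.nat_diff_reindex[symmetric])
  also have "\<dots> = (\<Prod>k<N. (1 + r ^ (2 * k + 1) / x) * (x * r powi (- (2 * int k + 1))))"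
  proof (intro prod.cong refl)
    fix k assume "k \<in> {..<N}"
    hence "2 * int (N - Suc k) + 1 - 2 * int N = - int (2 * k + 1)" by auto
    hence "1 + z * (r\<^sup>2) ^ (N - Suc k) = 1 + x / r ^ (2 * k + 1)"
      unfolding zk by (simp only: power_int_minus power_int_of_nat divide_inverse)
    also have "\<dots> = (1 + r ^ (2 * k + 1) / x) * (x / r ^ (2 * k + 1))"
      using assms by (simp add: field_simps)
    also have "x / r ^ (2 * k + 1) = x * r powi (- (2 * int k + 1))"
    proof -
      have "2 * int k + 1 = int (2 * k + 1)" by simp
      thus ?thesis by (simp only: divide_inverse power_int_minus power_int_of_nat)
    qed
    finally show "1 + z * (r\<^sup>2) ^ (N - Suc k) =
      (1 + r ^ (2 * k + 1) / x) * (x * r powi (- (2 * int k + 1)))" .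
  qed
  also have "\<dots> = (\<Prod>k<N. 1 + r ^ (2 * k + 1) / x) * (\<Prod>k<N. x * r powi (- (2 * int k + 1)))"
    by (rule prod.distrib)
  also have "(\<Prod>k<N. x * r powi (- (2 * int k + 1))) = x powi int N * r powi (- (int N * int N))"
  proof (induction N)
    case (Suc N)
    have e: "- (int (Suc N) * int (Suc N)) = - (int N * int N) + - (2 * int N + 1)"
      by (simp add: algebra_simps)
    show ?case unfolding e
      using Suc assms
        by (simp only: prod.lessThan_Suc power_int_of_nat power_Suc power_int_add simp_thms mult_ac)
  qed auto
  finally have "(\<Prod>k<N. (1 + x * r ^ (2 * k + 1)) * (1 + r ^ (2 * k + 1) / x)) *
       (x powi int N * r powi (- (int N * int N))) =
      (\<Sum>k\<le>2 * N. qbinom (r\<^sup>2) (2 * N) k * (r\<^sup>2) ^ (k * (k - 1) div 2) * z ^ k)"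
    unfolding qbinom_theorem by (simp add: prod.distrib mult_ac)
  also have "\<dots> = (\<Sum>k\<le>2 * N. qbinom (r\<^sup>2) (2 * N) k * theta_term r x (int k - int N) *
      (x powi int N * r powi (- (int N * int N))))"
  proof (intro sum.cong refl)
    fix k :: nat
    have even: "even (k * (k - 1))" by (cases k) auto
    have "(r\<^sup>2) ^ (k * (k - 1) div 2) = r ^ (k * (k - 1))"
      unfolding power_mult[symmetric] dvd_mult_div_cancel[OF even] ..
    also have "\<dots> = r powi (int k * int k - int k)"
    proof -
      have "int k * int k - int k = int (k * (k - 1))"
        by (cases k) (simp_all add: algebra_simps)
      thus ?thesis by (simp only: power_int_of_nat)
    qed
    finally have 1: "(r\<^sup>2) ^ (k * (k - 1) div 2) = r powi (int k * int k - int k)" .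
    have 2: "z ^ k = x powi int k * r powi (int k - 2 * int N * int k)"
    proof -
      have "(1 - 2 * int N) * int k = int k - 2 * int N * int k"
        by (simp add: algebra_simps)
      thus ?thesis
        by (simp only: z_def power_mult_distrib power_int_power' power_int_of_nat)
    qed
    have 3: "theta_term r x (int k - int N) * (x powi int N * r powi (- (int N * int N)))
       = (r powi ((int k - int N) * (int k - int N)) * r powi (- (int N * int N))) *
         (x powi (int k - int N) * x powi int N)"
      by (simp add: theta_term_def)
    also have "\<dots> = r powi ((int k - int N) * (int k - int N) + - (int N * int N)) * x powi (int k -
      int N + int N)"
      using assms by (simp only: power_int_add simp_thms)
    also have "(int k - int N) * (int k - int N) + - (int N * int N) =
      (int k * int k - int k) + (int k - 2 * int N * int k)"
      by (simp add: algebra_simps)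
    also have "int k - int N + int N = int k" by simp
    also have "r powi ((int k * int k - int k) + (int k - 2 * int N * int k)) * x powi int k =
        r powi (int k * int k - int k) * z ^ k"
      unfolding 2 using assms by (simp only: power_int_add simp_thms mult_ac)
    finally show "qbinom (r\<^sup>2) (2 * N) k * (r\<^sup>2) ^ (k * (k - 1) div 2) * z ^ k =
      qbinom (r\<^sup>2) (2 * N) k * theta_term r x (int k - int N) * (x powi int N * r powi (- (int N *
        int N)))"
      unfolding 1 by (simp only: mult.assoc)
  qed
  finally show ?thesis
    using assms by (simp flip: sum_distrib_right)
qed

lemma qfact_tendsto:
  assumes "norm s < 1"
  shows "(\<lambda>n. qfact s n) \<longlonglongrightarrow> qpoch_inf s s"
  using qpoch_inf_tendsto[OF assms, of s] by (simp add: qfact_def)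

lemma qfact_nonzero:
  assumes "norm s < 1"
  shows "qfact s n \<noteq> 0"
proof -
  have "norm (s ^ Suc i) < 1" for i
    using assms
      by (metis norm_ge_zero norm_power power_Suc_less_one power_eq_0_iff zero_less_norm_iff
      norm_zero order_le_less zero_less_one power_0_Suc)
  hence "s ^ Suc i \<noteq> 1" for i by (metis norm_one order_less_irrefl)
  thus ?thesis by (auto simp: qfact_def simp del: power_Suc)
qed

text \<open>
  The finite products \<open>qfact s n\<close> converge to a nonzero limit, so they and their inverses are
  bounded. This provides the dominating series in the passage to the limit.
\<close>

lemma qbinom_bounded:
  assumes "norm s < 1"
  shows "\<exists>B. \<forall>M k. norm (qbinom s M k) \<le> B"
proof -
  have L: "qpoch_inf s s \<noteq> 0"
    using assms by (intro qpoch_inf_nonzero) auto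
  obtain B where B: "\<And>n. norm (qfact s n) \<le> B"
    using convergent_imp_Bseq[OF convergentI[OF qfact_tendsto[OF assms]]] by (auto simp: Bseq_def)
  obtain C where C: "\<And>n. norm (inverse (qfact s n)) \<le> C"
    using convergent_imp_Bseq[OF convergentI[OF tendsto_inverse[OF qfact_tendsto[OF assms] L]]]
      by (auto simp: Bseq_def)
  have "norm (qbinom s M k) \<le> B * (C * C)" for M k
  proof (cases "k \<le> M")
    case True
    have "qbinom s M k = qfact s M * (inverse (qfact s k) * inverse (qfact s (M - k)))"
      using qbinom_qfact[OF True, of s] qfact_nonzero[OF assms] by (auto simp: field_simps)
    also have "norm \<dots> \<le> B * (C * C)"
      unfolding norm_mult
        using B[of 0] C[of 0] order_trans[OF norm_ge_zero B] order_trans[OF norm_ge_zero C]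
      by (intro mult_mono B C mult_nonneg_nonneg) auto
    finally show ?thesis .
  next
    case False
    have "0 \<le> B * (C * C)"
      using order_trans[OF norm_ge_zero B] order_trans[OF norm_ge_zero C] by simp
    thus ?thesis using False by (simp add: qbinom_eq_0)
  qed
  thus ?thesis by blast
qed

text \<open>
  In the finite version every Gaussian binomial coefficient tends to \<open>1 / (r\<^sup>2; r\<^sup>2)\<^sub>\<infinity>\<close>, and the
  limit may be taken termwise by dominated convergence.
\<close>

theorem jacobi_triple_product:
  assumes r: "norm r < 1" "r \<noteq> 0" and x: "x \<noteq> 0"
  shows "theta r x = qpoch_inf (- r * x) (r\<^sup>2) * qpoch_inf (- r / x) (r\<^sup>2) * qpoch_inf (r\<^sup>2) (r\<^sup>2)"
proof -
  define s where "s = r\<^sup>2"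
  have s: "norm s < 1"
    using r by (simp add: s_def norm_power power_less_one_iff)
  define L where "L = qpoch_inf s s"
  have L: "L \<noteq> 0"
    unfolding L_def using s by (intro qpoch_inf_nonzero) auto
  define f where "f N j = (if \<bar>j\<bar> \<le> int N then qbinom s (2 * N) (nat (int N + j)) *
    theta_term r x j else 0)" for N j
  obtain B where B: "\<And>M k. norm (qbinom s M k) \<le> B"
    using qbinom_bounded[OF s] by blast
  have B0: "B \<ge> 0" by (rule order_trans[OF norm_ge_zero B])
  have "(\<lambda>N. infsum (f N) UNIV) \<longlonglongrightarrow> infsum (\<lambda>j. theta_term r x j / L) UNIV"
  proof (rule tendsto_infsum_dominated_int[where M = "\<lambda>j. B * norm (theta_term r x j)"])
    show "(\<lambda>j. B * norm (theta_term r x j)) summable_on UNIV"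
      by (intro summable_on_cmult_right theta_term_abs_summable r)
    show "norm (f N j) \<le> B * norm (theta_term r x j)" for N j
      using B B0 by (auto simp: f_def norm_mult intro!: mult_right_mono)
    fix j
    have f1: "filterlim (\<lambda>N. 2 * N) at_top (sequentially :: nat filter)"
      by (rule filterlim_subseq) (auto simp: strict_mono_def)
    have f2: "filterlim (\<lambda>N. nat (int N + j)) sequentially sequentially" for j
      unfolding filterlim_at_top
    proof
      fix Z
      show "\<forall>\<^sub>F N in sequentially. Z \<le> nat (int N + j)"
        using eventually_ge_at_top[of "Z + nat \<bar>j\<bar>"] by eventually_elim auto
    qed
    have "(\<lambda>N. qfact s (2 * N) / (qfact s (nat (int N + j)) * qfact s (nat (int N + (- j)))) *
      theta_term r x j)
       \<longlonglongrightarrow> L / (L * L) * theta_term r x j"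
      unfolding L_def using L L_def
      by (intro tendsto_intros filterlim_compose[OF qfact_tendsto[OF s]] f1 f2) auto
    also have "L / (L * L) * theta_term r x j = theta_term r x j / L"
      using L by simp
    finally show "(\<lambda>N. f N j) \<longlonglongrightarrow> theta_term r x j / L"
    proof (rule Lim_transform_eventually)
      show "\<forall>\<^sub>F N in sequentially. qfact s (2 * N) / (qfact s (nat (int N + j)) *
        qfact s (nat (int N + (- j)))) *
          theta_term r x j = f N j"
        using eventually_ge_at_top[of "nat \<bar>j\<bar>"]
      proof eventually_elim
        case (elim N)
        have "2 * N - nat (int N + j) = nat (int N + (- j))" "nat (int N + j) \<le> 2 * N"
          using elim by auto
        thus ?case
          using qbinom_qfact[of "nat (int N + j)" "2 * N" s] qfact_nonzero[OF s] elim
          by (auto simp: f_def field_simps)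
      qed
    qed
  qed
  moreover have "infsum (f N) UNIV = (\<Prod>k<N. (1 - (- r * x) * s ^ k) * (1 - (- r / x) * s ^ k))" for N
  proof -
    have "infsum (f N) UNIV = infsum (f N) {- int N..int N}"
      by (rule infsum_cong_neutral) (auto simp: f_def)
    also have "\<dots> = (\<Sum>j\<in>{- int N..int N}. f N j)"
      by simp
    also have "\<dots> = (\<Sum>k\<le>2 * N. qbinom s (2 * N) k * theta_term r x (int k - int N))"
      by (rule sum.reindex_bij_witness[of _ "\<lambda>k. int k - int N" "\<lambda>j. nat (int N + j)"])
         (auto simp: f_def)
    also have "\<dots> = (\<Prod>k<N. (1 + x * r ^ (2 * k + 1)) * (1 + r ^ (2 * k + 1) / x))"
      unfolding s_def by (rule finite_jacobi_triple_product[symmetric]) (use r x in auto)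
    also have "\<dots> = (\<Prod>k<N. (1 - (- r * x) * s ^ k) * (1 - (- r / x) * s ^ k))"
      by (simp add: s_def mult_ac flip: power_mult)
    finally show ?thesis .
  qed
  moreover have "(\<lambda>N. \<Prod>k<N. (1 - (- r * x) * s ^ k) * (1 - (- r / x) * s ^ k)) \<longlonglongrightarrow>
      qpoch_inf (- r * x) s * qpoch_inf (- r / x) s"
    unfolding prod.distrib by (intro tendsto_mult qpoch_inf_tendsto s)
  moreover have "infsum (\<lambda>j. theta_term r x j / L) UNIV = theta r x / L"
    unfolding divide_inverse theta_def by (rule infsum_cmult_left')
  ultimately have "theta r x / L = qpoch_inf (- r * x) s * qpoch_inf (- r / x) s"
    using LIMSEQ_unique by simp
  thus ?thesis
    using L by (simp add: L_def s_def field_simps)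
qed

section \<open>Splitting products of theta series along sublattices\<close>

text \<open>
  The common pattern of both dissections: if \<open>\<int>\<^sup>2\<close> is partitioned into finitely many cosets of a
  sublattice, and on each of them the general term of a product of two theta series becomes, in
  coordinates \<open>(a, b)\<close> of the coset, a constant times the general term of another such product,
  then the product of the two series is the corresponding finite combination. The map \<open>\<Phi>\<close> sends
  the index \<open>j\<close> of a coset and the coordinates \<open>(a, b)\<close> to a lattice point.
\<close>

lemma theta_product_dissection:
  assumes r: "norm r < 1" and r': "norm r' < 1"
    and J: "finite J"
    and bij: "bij_betw \<Phi> (J \<times> UNIV) UNIV"
    and term_eq: "\<And>j a b m n. j \<in> J \<Longrightarrow> \<Phi> (j, a, b) = (m, n) \<Longrightarrow>
      theta_term r x m * theta_term r y n = c j * (theta_term r' (u j) a * theta_term r' (v j) b)"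
  shows "theta r x * theta r y = (\<Sum>j\<in>J. c j * (theta r' (u j) * theta r' (v j)))"
proof -
  define f where "f = (\<lambda>(m, n). theta_term r x m * theta_term r y n)"
  have "(f has_sum theta r x * theta r y) UNIV"
    unfolding f_def by (rule theta_mult_has_sum[OF r])
  hence "((\<lambda>p. f (\<Phi> p)) has_sum theta r x * theta r y) (J \<times> UNIV)"
    by (simp add: has_sum_reindex_bij_betw[OF bij])
  hence "((\<lambda>j. c j * (theta r' (u j) * theta r' (v j))) has_sum theta r x * theta r y) J"
  proof (rule has_sum_SigmaD)
    fix j assume j: "j \<in> J"
    have "f (\<Phi> (j, p)) = c j * (case p of (a, b) \<Rightarrow> theta_term r' (u j) a * theta_term r' (v j) b)" for p
      using term_eq[OF j, of "fst p" "snd p" "fst (\<Phi> (j, p))" "snd (\<Phi> (j, p))"]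
      by (simp add: f_def case_prod_unfold)
    thus "((\<lambda>p. f (\<Phi> (j, p))) has_sum c j * (theta r' (u j) * theta r' (v j))) UNIV"
      by (simp only:) (intro has_sum_cmult_right theta_mult_has_sum r')
  qed
  thus ?thesis
    using has_sum_finite[OF J] has_sum_unique by blast
qed

text \<open>
  If \<open>m = a + b + j\<close> and \<open>n = a - b\<close> with \<open>j \<in> {0, 1}\<close>, then \<open>m + n = 2 a + j\<close> and
  \<open>m - n = 2 b + j\<close>, and \<open>2 (m\<^sup>2 + n\<^sup>2) = (m + n)\<^sup>2 + (m - n)\<^sup>2\<close> separates the variables.
\<close>

lemma theta_parity_split:
  assumes r: "norm r < 1" "r \<noteq> 0" and x: "x \<noteq> 0" and y: "y \<noteq> 0"
  shows "theta r (x * y) * theta r (x / y) =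
    theta (r\<^sup>2) (x\<^sup>2) * theta (r\<^sup>2) (y\<^sup>2) +
    r * x * y * (theta (r\<^sup>2) (r\<^sup>2 * x\<^sup>2) * theta (r\<^sup>2) (r\<^sup>2 * y\<^sup>2))"
proof -
  define c where "c = (\<lambda>j :: int. if j = 0 then 1 else r * x * y)"
  define u where "u = (\<lambda>j :: int. if j = 0 then x\<^sup>2 else r\<^sup>2 * x\<^sup>2)"
  define v where "v = (\<lambda>j :: int. if j = 0 then y\<^sup>2 else r\<^sup>2 * y\<^sup>2)"
  have "theta r (x * y) * theta r (x / y) =
    (\<Sum>j\<in>{0, 1}. c j * (theta (r\<^sup>2) (u j) * theta (r\<^sup>2) (v j)))"
  proof (rule theta_product_dissection[where \<Phi> = "\<lambda>(j, a, b). (a + b + j, a - b)"])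
    show "norm (r\<^sup>2) < 1" using r by (simp add: norm_power power_less_one_iff)
    show "bij_betw (\<lambda>(j, a, b). (a + b + j, a - b)) ({0, 1} \<times> UNIV) (UNIV :: (int \<times> int) set)"
      by (rule bij_betw_byWitness[where f' =
        "\<lambda>(m, n). ((m + n) mod 2, (m + n) div 2, (m + n) div 2 - n)"])
         (auto simp: minus_mod_eq_div_mult, presburger+)
    fix j a b m n :: int
    assume j: "j \<in> {0, 1}" and "(case (j, a, b) of (j, a, b) \<Rightarrow> (a + b + j, a - b)) = (m, n)"
    hence m: "m = a + b + j" and n: "n = a - b" by auto
    have "theta_term r (x * y) m * theta_term r (x / y) n =
        r powi (m * m + n * n) * x powi (m + n) * y powi (m - n)"
      using r x y by (simp add: theta_term_def power_int_add power_int_diff power_int_mult_distrib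
           power_int_divide_distrib)
    also have "m * m + n * n = 2 * (a * a) + 2 * (b * b) + (j * (2 * a) + j * (2 * b) + j)"
      using j by (auto simp: m n algebra_simps)
    also have "m + n = 2 * a + j" by (simp add: m n)
    also have "m - n = 2 * b + j" by (simp add: m n)
    also have "r powi (2 * (a * a) + 2 * (b * b) + (j * (2 * a) + j * (2 * b) + j)) * x powi (2 *
      a + j) * y powi (2 * b + j) =
      c j * (theta_term (r\<^sup>2) (u j) a * theta_term (r\<^sup>2) (v j) b)"
      using j r x y
      by (auto simp: c_def u_def v_def theta_term_def power_int_add power_int_mult_distrib
        power_int_power)
    finally show "theta_term r (x * y) m * theta_term r (x / y) n =
      c j * (theta_term (r\<^sup>2) (u j) a * theta_term (r\<^sup>2) (v j) b)" .
  qed (use r in auto)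
  thus ?thesis
    by (simp add: c_def u_def v_def)
qed

text \<open>
  With \<open>m = 2 a - b\<close> and \<open>n = a + 2 b + j\<close> the point \<open>m + n \<i>\<close> equals \<open>(2 + \<i>)(a + b \<i>) + j \<i>\<close>,
  so that \<open>m\<^sup>2 + n\<^sup>2 = 5 a\<^sup>2 + 5 b\<^sup>2 + 2 j (a + 2 b) + j\<^sup>2\<close> without mixed terms in \<open>a\<close> and \<open>b\<close>.
  The coset is determined by \<open>j \<equiv> 2 m + n\<close> modulo 5; the representatives \<open>-2, \<dots>, 2\<close> keep the
  exponents small.
\<close>

lemma theta_five_dissection:
  assumes r: "norm r < 1" "r \<noteq> 0" and x: "x \<noteq> 0" and y: "y \<noteq> 0"
  shows "theta r x * theta r y = (\<Sum>j\<in>{-2..2}. r powi (j * j) * y powi j *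
    (theta (r ^ 5) (r powi (2 * j) * x\<^sup>2 * y) * theta (r ^ 5) (r powi (4 * j) * y\<^sup>2 / x)))"
proof (rule theta_product_dissection[where \<Phi> = "\<lambda>(j, a, b). (2 * a - b, a + 2 * b + j)"])
  show "norm (r ^ 5) < 1" using r by (simp add: norm_power power_less_one_iff)
  define J where "J = (\<lambda>m k :: int. (2 * m + k + 2) mod 5 - 2)"
  show "bij_betw (\<lambda>(j, a, b). (2 * a - b, a + 2 * b + j)) ({-2..2} \<times> UNIV) (UNIV :: (int \<times> int) set)"
  proof (rule bij_betw_byWitness[where f' =
    "\<lambda>(m, k). (J m k, (2 * m + (k - J m k)) div 5, (2 * (k - J m k) - m) div 5)"])
    have *: "J (2 * a - b) (a + 2 * b + j) = j" if "j \<in> {-2..2}" for a b j :: int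
    proof -
      have "2 * (2 * a - b) + (a + 2 * b + j) + 2 = j + 2 + 5 * a" by simp
      moreover have "(j + 2 + 5 * a) mod 5 = (j + 2) mod 5" by (rule mod_mult_self2)
      moreover have "(j + 2) mod 5 = j + 2" using that by (intro mod_pos_pos_trivial) auto
      ultimately show ?thesis by (simp only: J_def add_diff_cancel_right')
    qed
    show "\<forall>p\<in>{-2..2} \<times> UNIV. (\<lambda>(m, k). (J m k, (2 * m + (k - J m k)) div 5, (2 * (k - J m k) - m) div 5))
       (case p of (j, a, b) \<Rightarrow> (2 * a - b, a + 2 * b + j)) = p"
      by (auto simp: *)
    have **: "\<exists>d. 2 * m + k = 5 * d + J m k" for m k
      by (rule exI[of _ "(2 * m + k + 2) div 5"]) (simp add: J_def minus_mod_eq_mult_div [symmetric])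
    show "\<forall>p\<in>UNIV. (case (case p of (m, k) \<Rightarrow> (J m k, (2 * m + (k - J m k)) div 5, (2 * (k - J m k) -
      m) div 5)) of
        (j, a, b) \<Rightarrow> (2 * a - b, a + 2 * b + j)) = p"
    proof (clarify, intro conjI)
      fix m k :: int
      obtain d where d: "2 * m + k = 5 * d + J m k" using ** by blast
      have "2 * m + (k - J m k) = 5 * d" "2 * (k - J m k) - m = 5 * (2 * d - m)" using d by auto
      hence e: "(2 * m + (k - J m k)) div 5 = d" "(2 * (k - J m k) - m) div 5 = 2 * d - m" by simp_all
      show "2 * ((2 * m + (k - J m k)) div 5) - (2 * (k - J m k) - m) div 5 = m"
        "(2 * m + (k - J m k)) div 5 + 2 * ((2 * (k - J m k) - m) div 5) + J m k = k"
        unfolding e using d by auto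
    qed
    have "J m k \<in> {-2..2}" for m k
      using pos_mod_bound[of 5 "2 * m + k + 2"] pos_mod_sign[of 5 "2 * m + k + 2"] by (simp add: J_def)
    thus "(\<lambda>(m, k). (J m k, (2 * m + (k - J m k)) div 5, (2 * (k - J m k) -
      m) div 5)) ` UNIV \<subseteq> {-2..2} \<times> UNIV"
      by auto
  qed auto
  fix j a b m n :: int
  assume "(case (j, a, b) of (j, a, b) \<Rightarrow> (2 * a - b, a + 2 * b + j)) = (m, n)"
  hence m: "m = 2 * a - b" and n: "n = a + 2 * b + j" by auto
  have "theta_term r x m * theta_term r y n = r powi (m * m + n * n) * x powi m * y powi n"
    using r by (simp add: theta_term_def power_int_add)
  also have "m * m + n * n = 5 * (a * a) + 5 * (b * b) + (2 * j * a + 4 * j * b + j * j)"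
    by (simp add: m n algebra_simps)
  also have "r powi (5 * (a * a) + 5 * (b * b) + (2 * j * a + 4 * j * b + j * j)) * x powi m * y powi n =
     r powi (j * j) * y powi j * (theta_term (r ^ 5) (r powi (2 * j) * x\<^sup>2 * y) a *
        theta_term (r ^ 5) (r powi (4 * j) * y\<^sup>2 / x) b)"
    using r x y
    by (simp add: m n theta_term_def power_int_add power_int_diff power_int_mult_distrib
           power_int_divide_distrib power_int_power flip: power_int_mult)
  finally show "theta_term r x m * theta_term r y n =
     r powi (j * j) * y powi j * (theta_term (r ^ 5) (r powi (2 * j) * x\<^sup>2 * y) a *
        theta_term (r ^ 5) (r powi (4 * j) * y\<^sup>2 / x) b)" .
qed (use r in auto)

section \<open>Three-term relations\<close>

text \<open>
  These are three-term relations of Weierstrass type. With \<open>U\<close> the theta series to base \<open>q\<^sup>1\<^sup>0\<close>,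
  the parity split writes each product \<open>T (\<plusminus> q\<^bsup>k + l\<^esup>) * T (\<plusminus> q\<^bsup>k - l\<^esup>)\<close> as
  \<open>a\<^sub>k a\<^sub>l \<plusminus> q\<^bsup>5 + k + l\<^esup> e\<^sub>k e\<^sub>l\<close>, where \<open>a\<^sub>k = U (q\<^bsup>2 k\<^esup>)\<close> and \<open>e\<^sub>k = U (q\<^bsup>2 k + 10\<^esup>)\<close>;
  quasi-periodicity turns \<open>a\<^sub>3\<close> and \<open>e\<^sub>3\<close> into \<open>e\<^sub>2\<close> and \<open>a\<^sub>2\<close> up to powers of \<open>q\<close>. The three
  claims thereby become polynomial identities; each of them factors the difference of two
  products of such bilinear forms.
\<close>

lemma theta_level5_relations:
  fixes q :: complex
  assumes q: "norm q < 1" "q \<noteq> 0"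
  defines "T \<equiv> theta (q ^ 5)"
  shows "T (q ^ 4) * T 1 * (T (q\<^sup>2))\<^sup>2 - q * (T (q ^ 5) * T q * (T (q ^ 3))\<^sup>2) =
           T (- (q ^ 4)) * T (- 1) * (T (- (q\<^sup>2)))\<^sup>2"
    and "T (q ^ 3) * T q * (T (q ^ 5) * T q) - T (q ^ 4) * T 1 * (T (q ^ 4) * T (q\<^sup>2)) =
           T (- (q ^ 4)) * T (- 1) * (T (- (q ^ 4)) * T (- (q\<^sup>2)))"
    and "(T (q ^ 3) * T q)\<^sup>2 - q * (T (q ^ 4) * T (q\<^sup>2))\<^sup>2 =
           T (- (q ^ 4)) * T (- 1) * (T (- (q\<^sup>2)) * T (- 1))"
proof -
  define U where "U = theta (q ^ 10)"
  define a where "a = (\<lambda>k::nat. U (q ^ (2 * k)))"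
  define e where "e = (\<lambda>k::nat. U (q ^ (2 * k + 10)))"
  have q5: "norm (q ^ 5) < 1"
    using q by (simp add: norm_power power_less_one_iff)
  have split: "T (s * q ^ (k + l)) * T (s * q ^ (k - l)) =
      U (q ^ (2 * k)) * U (q ^ (2 * l)) + s * q ^ (5 + k + l) * (U (q ^ (2 * k + 10)) * U (q ^ (2 *
        l + 10)))"
    if "s * s = 1" "l \<le> k" for s k l
  proof -
    have "s \<noteq> 0" using that by auto
    have "(s * q ^ k)\<^sup>2 = (s * s) * q ^ (2 * k)"
      by (simp add: power_mult_distrib power2_eq_square[of s] mult.commute flip: power_mult)
    moreover have "s * q ^ k * q ^ l = s * q ^ (k + l)" "s * q ^ k / q ^ l = s * q ^ (k - l)"
      using that q by (simp_all add: power_add power_diff)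
    moreover have "(q ^ l)\<^sup>2 = q ^ (2 * l)"
      by (simp add: mult.commute flip: power_mult)
    moreover have "(q ^ 5)\<^sup>2 = q ^ 10"
      by (simp flip: power_mult)
    ultimately show ?thesis
      using theta_parity_split[of "q ^ 5" "s * q ^ k" "q ^ l"] q5 q that \<open>s \<noteq> 0\<close>
      by (simp add: T_def U_def power_add mult_ac)
  qed
  have U_shift: "U (q ^ 20 / x) = U x * x / q ^ 10" if "x \<noteq> 0" for x
    using theta_quasiperiod[of "q ^ 10" "inverse x"] q that
    by (simp add: U_def theta_inverse divide_inverse flip: power_mult)
  have "q ^ 20 / q ^ 6 = q ^ 14" "q ^ 20 / q ^ 4 = q ^ 16"
    using q by (simp_all flip: power_diff)
  moreover have "q ^ 4 * (x * q ^ 6) / q ^ 10 = x" "x * q ^ 4 / q ^ 10 = x / q ^ 6" for x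
    using q by (simp_all add: eval_nat_numeral)
  ultimately have U6: "U (q ^ 6) = q ^ 4 * e 2" and U16: "U (q ^ 16) = a 2 / q ^ 6"
    using U_shift[of "q ^ 6"] U_shift[of "q ^ 4"] q by (simp_all add: a_def e_def)
  have cancel: "q ^ 8 * x / q ^ 6 = q\<^sup>2 * x" "q ^ 9 * x / q ^ 6 = q ^ 3 * x" "q ^ 10 * x / q ^ 6 =
    q ^ 4 * x" for x
    using q by (simp_all add: eval_nat_numeral)
  have 1: "T (q ^ 4) * T 1 = (a 2)\<^sup>2 + q ^ 9 * (e 2)\<^sup>2"
    using split[of 1 2 2] by (simp add: a_def e_def power2_eq_square)
  have 2: "T (q ^ 3) * T q = a 2 * a 1 + q ^ 8 * (e 2 * e 1)"
    using split[of 1 1 2] by (simp add: a_def e_def)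
  have 3: "(T (q\<^sup>2))\<^sup>2 = a 2 * a 0 + q ^ 7 * (e 2 * e 0)"
    using split[of 1 0 2] by (simp add: a_def e_def power2_eq_square[of "T _"])
  have 4: "T (q ^ 4) * T (q\<^sup>2) = q ^ 4 * (e 2 * a 1) + q ^ 3 * (a 2 * e 1)"
    using split[of 1 1 3] q by (simp add: U6 U16) (simp add: a_def e_def cancel)
  have 5: "T (q ^ 5) * T q = 2 * q ^ 4 * (a 2 * e 2)"
    using split[of 1 2 3] q by (simp add: U6 U16) (simp add: a_def e_def cancel)
  have 6: "(T (q ^ 3))\<^sup>2 = q ^ 4 * (e 2 * a 0) + q\<^sup>2 * (a 2 * e 0)"
    using split[of 1 0 3] q
      by (simp add: U6 U16) (simp add: a_def e_def power2_eq_square[of "T _"] cancel)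
  have 7: "T (- (q ^ 4)) * T (- 1) = (a 2)\<^sup>2 - q ^ 9 * (e 2)\<^sup>2"
    using split[of "-1" 2 2] by (simp add: a_def e_def power2_eq_square)
  have 8: "T (- (q\<^sup>2)) * T (- 1) = (a 1)\<^sup>2 - q ^ 7 * (e 1)\<^sup>2"
    using split[of "-1" 1 1] by (simp add: a_def e_def flip: power2_eq_square)
  have 9: "(T (- (q\<^sup>2)))\<^sup>2 = a 2 * a 0 - q ^ 7 * (e 2 * e 0)"
    using split[of "-1" 0 2] by (simp add: a_def e_def power2_eq_square[of "T _"])
  have 10: "T (- (q ^ 4)) * T (- (q\<^sup>2)) = q ^ 4 * (e 2 * a 1) - q ^ 3 * (a 2 * e 1)"
    using split[of "-1" 1 3] q by (simp add: U6 U16) (simp add: a_def e_def cancel)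
  show "T (q ^ 4) * T 1 * (T (q\<^sup>2))\<^sup>2 - q * (T (q ^ 5) * T q * (T (q ^ 3))\<^sup>2) =
           T (- (q ^ 4)) * T (- 1) * (T (- (q\<^sup>2)))\<^sup>2"
    unfolding 1 3 5 6 7 9 by algebra
  show "T (q ^ 3) * T q * (T (q ^ 5) * T q) - T (q ^ 4) * T 1 * (T (q ^ 4) * T (q\<^sup>2)) =
           T (- (q ^ 4)) * T (- 1) * (T (- (q ^ 4)) * T (- (q\<^sup>2)))"
    unfolding 2 5 1 4 7 10 by algebra
  show "(T (q ^ 3) * T q)\<^sup>2 - q * (T (q ^ 4) * T (q\<^sup>2))\<^sup>2 =
           T (- (q ^ 4)) * T (- 1) * (T (- (q\<^sup>2)) * T (- 1))"
    unfolding 2 4 7 8 by algebra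
qed

text \<open>
  With \<open>p\<^sup>2 = q\<close> the base \<open>p\<^sup>5\<close> is a square root of \<open>q\<^sup>5\<close>, so for odd \<open>k\<close> these are the products
  \<open>(q\<^sup>a, q\<^bsup>5 - a\<^esup>, q\<^sup>5; q\<^sup>5)\<^sub>\<infinity>\<close> of Rogers-Ramanujan type.
\<close>

lemma theta_half_base_product:
  assumes p: "norm p < 1" "p \<noteq> 0" and k: "k \<le> 5"
  shows "theta (p ^ 5) (- (p ^ k)) =
    qpoch_inf (p ^ (5 + k)) (p ^ 10) * qpoch_inf (p ^ (5 - k)) (p ^ 10) * qpoch_inf (p ^ 10) (p ^ 10)"
proof -
  have "norm (p ^ 5) < 1"
    using p by (simp add: norm_power power_less_one_iff)
  moreover have "p ^ 5 / p ^ k = p ^ (5 - k)"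
    using k p by (simp add: power_diff)
  ultimately show ?thesis
    using jacobi_triple_product[of "p ^ 5" "- (p ^ k)"] p by (simp add: power_add flip: power_mult)
qed

lemma theta_product_nat:
  assumes q: "norm q < 1" "q \<noteq> 0" and k: "k \<le> n" and n: "n > 0"
  shows "theta (q ^ n) (q ^ k) =
      qpoch_inf (- (q ^ (n + k))) (q ^ (2 * n)) * qpoch_inf (- (q ^ (n - k))) (q ^ (2 * n)) *
        qpoch_inf (q ^ (2 * n)) (q ^ (2 * n))"
    and "theta (q ^ n) (- (q ^ k)) =
      qpoch_inf (q ^ (n + k)) (q ^ (2 * n)) * qpoch_inf (q ^ (n - k)) (q ^ (2 * n)) *
        qpoch_inf (q ^ (2 * n)) (q ^ (2 * n))"
proof -
  have "norm (q ^ n) < 1"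
    using q n by (simp add: norm_power power_less_one_iff)
  moreover have "q ^ n / q ^ k = q ^ (n - k)"
    using k q by (simp add: power_diff)
  moreover have "(q ^ n)\<^sup>2 = q ^ (2 * n)"
    by (simp add: mult.commute flip: power_mult)
  ultimately show "theta (q ^ n) (q ^ k) =
      qpoch_inf (- (q ^ (n + k))) (q ^ (2 * n)) * qpoch_inf (- (q ^ (n - k))) (q ^ (2 * n)) *
        qpoch_inf (q ^ (2 * n)) (q ^ (2 * n))"
    and "theta (q ^ n) (- (q ^ k)) =
      qpoch_inf (q ^ (n + k)) (q ^ (2 * n)) * qpoch_inf (q ^ (n - k)) (q ^ (2 * n)) *
        qpoch_inf (q ^ (2 * n)) (q ^ (2 * n))"
    using jacobi_triple_product[of "q ^ n" "q ^ k"] jacobi_triple_product[of "q ^ n" "- (q ^ k)"] q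
    by (simp_all add: power_add)
qed

text \<open>
  The series \<open>\<phi>(q) = theta q 1\<close> and \<open>2 \<psi>(q\<^sup>2) = theta q q\<close> have base \<open>q\<close>, all others base \<open>q\<^sup>5\<close>,
  so the parity split does not relate them directly. As products, however, they are
  \<open>T(q\<^sup>4)\<^sup>2 T(q\<^sup>2)\<^sup>2 T(1)\<close> and \<open>T(q\<^sup>3)\<^sup>2 T(q)\<^sup>2 T(q\<^sup>5)\<close> times the same factor
  \<open>(q\<^sup>2; q\<^sup>2)\<^sub>\<infinity> / (q\<^sup>1\<^sup>0; q\<^sup>1\<^sup>0)\<^sub>\<infinity>\<^sup>5\<close>. Inserting this makes the relations of level 5 applicable,
  and it remains to recognise the resulting products.
\<close>

lemma theta_square_identities:
  fixes p q :: complex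
  assumes p: "norm p < 1" "p \<noteq> 0" and q_def: "q = p\<^sup>2"
  defines "T \<equiv> theta (q ^ 5)" and "X \<equiv> theta (p ^ 5) (- p)" and "Y \<equiv> theta (p ^ 5) (- (p ^ 3))"
  shows "theta q 1 * T q - q * (theta q q * T (q ^ 4)) = X\<^sup>2"
    and "theta q q * T (q\<^sup>2) - theta q 1 * T (q ^ 3) = Y\<^sup>2"
    and "theta q q * T 1 - q * (theta q 1 * T (q ^ 5)) = 2 * X * Y"
proof -
  have q: "norm q < 1" "q \<noteq> 0"
    using p by (simp_all add: q_def norm_power power_less_one_iff)
  have base: "norm (q ^ k) < 1" if "k > 0" for k
    using q that by (simp add: norm_power power_less_one_iff)
  define w where "w = (\<lambda>k. qpoch_inf (q ^ k) (q ^ 10))"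
  define v where "v = (\<lambda>k. qpoch_inf (- (q ^ k)) (q ^ 10))"
  define K where "K = w 2 * w 4 * w 6 * w 8"
  \<comment> \<open>The three identities are proved multiplied
    by the fourth power of this factor, which is then cancelled.\<close>
  have w10: "w 10 \<noteq> 0"
    unfolding w_def by (intro qpoch_inf_nonzero base) auto
  have v0: "v 0 = 2 * v 10"
    using qpoch_inf_head[of "q ^ 10" "-1"] base by (simp add: v_def)

  have T: "T 1 = v 5 * v 5 * w 10" "T q = v 6 * v 4 * w 10" "T (q\<^sup>2) = v 7 * v 3 * w 10"
    "T (q ^ 3) = v 8 * v 2 * w 10" "T (q ^ 4) = v 9 * v 1 * w 10" "T (q ^ 5) = v 10 * v 0 * w 10"
    "T (- 1) = w 5 * w 5 * w 10" "T (- (q\<^sup>2)) = w 7 * w 3 * w 10" "T (- (q ^ 4)) = w 9 * w 1 * w 10"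
    using theta_product_nat[OF q, of 0 5] theta_product_nat[OF q, of 1 5] theta_product_nat[OF q, of 2 5]
      theta_product_nat[OF q, of 3 5] theta_product_nat[OF q, of 4 5] theta_product_nat[OF q, of 5 5]
    by (simp_all add: T_def v_def w_def)
  have base5: "qpoch_inf a (q ^ 5) = qpoch_inf a (q ^ 10) * qpoch_inf (a * q ^ 5) (q ^ 10)" for a
    using qpoch_inf_split[of "q ^ 5" 2 a] base by (simp add: numeral_2_eq_2 flip: power_mult)
  have p_q: "p ^ 2 = q" "p ^ 4 = q ^ 2" "p ^ 6 = q ^ 3" "p ^ 8 = q ^ 4" "p ^ 10 = q ^ 5"
    by (simp_all add: q_def flip: power_mult)
  have X: "X = (w 3 * w 8) * (w 2 * w 7) * (w 5 * w 10)"
    using theta_half_base_product[OF p, of 1]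
    by (simp add: X_def p_q base5 w_def flip: power_add)
  have Y: "Y = (w 4 * w 9) * (w 1 * w 6) * (w 5 * w 10)"
    using theta_half_base_product[OF p, of 3]
    by (simp add: Y_def p_q base5 w_def flip: power_add power_Suc)
  have base2: "qpoch_inf a (q\<^sup>2) =
    qpoch_inf a (q ^ 10) * qpoch_inf (a * q ^ 2) (q ^ 10) * qpoch_inf (a * q ^ 4) (q ^ 10)
      * qpoch_inf (a * q ^ 6) (q ^ 10) * qpoch_inf (a * q ^ 8) (q ^ 10)" for a
    using qpoch_inf_split[of "q ^ 2" 5 a] base
      by (simp add: eval_nat_numeral(2,3) lessThan_Suc mult_ac flip: power_mult power_Suc)
  have phi: "theta q 1 = (v 1 * v 3 * v 5 * v 7 * v 9) * (v 1 * v 3 * v 5 * v 7 * v 9) * (K * w 10)"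
    using theta_product_nat(1)[OF q, of 0 1]
    by (simp add: base2 v_def w_def K_def numeral_2_eq_2[symmetric] flip: power_add power_Suc)
  have psi: "theta q q = (v 2 * v 4 * v 6 * v 8 * v 10) * (v 0 * v 2 * v 4 * v 6 * v 8) * (K * w 10)"
    using theta_product_nat(1)[OF q, of 1 1]
    by (simp add: base2 v_def w_def K_def numeral_2_eq_2[symmetric] flip: power_add power_Suc)
  define z where "z = (\<lambda>k. qpoch_inf (q ^ k) (q ^ 20))"
  have wv: "w k * v k = z (2 * k)" for k
    using qpoch_inf_mult_uminus[OF base, of 10 "q ^ k"]
    by (simp add: w_def v_def z_def mult.commute flip: power_mult)
  have wz: "w k = z k * z (k + 10)" for k
    using qpoch_inf_split[of "q ^ 10" 2 "q ^ k"] base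
    by (simp add: w_def z_def numeral_2_eq_2 flip: power_mult power_add)
  \<comment> \<open>All factors to base \<open>q\<^sup>1\<^sup>0\<close> are broken up into factors to base \<open>q\<^sup>2\<^sup>0\<close>.\<close>
  have R1: "w 2 * w 8 = (w 1 * v 1) * (w 9 * v 9) * (w 4 * v 4) * (w 6 * v 6)"
    unfolding wv by (simp add: wz mult_ac)
  have R2: "w 4 * w 6 = (w 2 * v 2) * (w 7 * v 7) * (w 3 * v 3) * (w 8 * v 8)"
    unfolding wv by (simp add: wz mult_ac)
  \<comment> \<open>Euler's identity \<open>(q; q\<^sup>2)\<^sub>\<infinity> (- q; q)\<^sub>\<infinity> = 1\<close> at \<open>q\<^sup>5\<close>.\<close>
  have R3: "w 5 * v 5 * v 10 = 1"
  proof -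
    have "w 10 * (w 5 * v 5 * v 10) = (w 5 * v 5) * (w 10 * v 10)"
      by (simp add: mult_ac)
    also have "\<dots> = w 10 * 1"
      unfolding wv using wz[of 10] by simp
    finally show ?thesis using w10 by simp
  qed
  note level5 = theta_level5_relations[OF q, folded T_def]
  have "(w 10) ^ 4 * (theta q 1 * T q - q * (theta q q * T (q ^ 4))) =
      K * T (q ^ 4) * T q * (T (q ^ 4) * T 1 * (T (q\<^sup>2))\<^sup>2 - q * (T (q ^ 5) * T q * (T (q ^ 3))\<^sup>2))"
    unfolding T phi psi by algebra
  also have "\<dots> = (w 2 * w 8) * ((w 1 * v 1) * (w 9 * v 9) * (w 4 * v 4) * (w 6 * v 6)) *
      ((w 5)\<^sup>2 * (w 3)\<^sup>2 * (w 7)\<^sup>2 * (w 10) ^ 6)"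
    unfolding level5 unfolding T K_def by algebra
  also have "\<dots> = (w 10) ^ 4 * X\<^sup>2"
    unfolding R1[symmetric] X by algebra
  finally show "theta q 1 * T q - q * (theta q q * T (q ^ 4)) = X\<^sup>2"
    using w10 by simp
  have "(w 10) ^ 4 * (theta q q * T (q\<^sup>2) - theta q 1 * T (q ^ 3)) =
      K * T (q\<^sup>2) * T (q ^ 3) *
      (T (q ^ 3) * T q * (T (q ^ 5) * T q) - T (q ^ 4) * T 1 * (T (q ^ 4) * T (q\<^sup>2)))"
    unfolding T phi psi by algebra
  also have "\<dots> = (w 4 * w 6) * ((w 2 * v 2) * (w 7 * v 7) * (w 3 * v 3) * (w 8 * v 8)) *
      ((w 5)\<^sup>2 * (w 1)\<^sup>2 * (w 9)\<^sup>2 * (w 10) ^ 6)"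
    unfolding level5 unfolding T K_def by algebra
  also have "\<dots> = (w 10) ^ 4 * Y\<^sup>2"
    unfolding R2[symmetric] Y by algebra
  finally show "theta q q * T (q\<^sup>2) - theta q 1 * T (q ^ 3) = Y\<^sup>2"
    using w10 by simp
  have "(w 10) ^ 4 * (theta q q * T 1 - q * (theta q 1 * T (q ^ 5))) =
      K * T 1 * T (q ^ 5) * ((T (q ^ 3) * T q)\<^sup>2 - q * (T (q ^ 4) * T (q\<^sup>2))\<^sup>2)"
    unfolding T phi psi by algebra
  also have "\<dots> = 2 * (w 5 * v 5 * v 10)\<^sup>2 * (K * w 1 * w 3 * w 7 * w 9 * (w 5)\<^sup>2 * (w 10) ^ 6)"
    unfolding level5 unfolding T v0 by algebra
  also have "\<dots> = (w 10) ^ 4 * (2 * X * Y)"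
    unfolding R3 power_one mult_1_right X Y K_def by algebra
  finally show "theta q q * T 1 - q * (theta q 1 * T (q ^ 5)) = 2 * X * Y"
    using w10 by simp
qed

section \<open>The dissection as an identity between functions\<close>

text \<open>
  The parity split of \<open>\<theta>(p)\<^sup>2\<close> produces \<open>\<phi>(q\<^sup>5)\<close> and \<open>\<psi>(q\<^sup>1\<^sup>0)\<close>, which already are functions of
  \<open>Q = q\<^sup>5\<close>, multiplied by theta series at \<open>q\<close> and \<open>q\<^sup>4\<close>. The five-dissection is applied to the
  product of each of the latter with \<open>\<theta>(- q\<^sup>3)\<close>, and the powers of \<open>q\<close> in front are collected by
  their residue modulo 5.
\<close>

lemma theta_numerator_dissection:
  fixes p q Q P :: complex
  assumes p: "norm p < 1" "p \<noteq> 0"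
  defines "q \<equiv> p\<^sup>2" and "P \<equiv> p ^ 5" and "Q \<equiv> q ^ 5"
  defines "X \<equiv> theta (P ^ 5) (- P)" and "Y \<equiv> theta (P ^ 5) (- (P ^ 3))"
  shows "(theta (p ^ 5) p)\<^sup>2 * theta (q ^ 5) (- (q ^ 3)) =
    theta (Q ^ 5) (- Q) * X\<^sup>2 + q\<^sup>2 * (theta (Q ^ 5) (- Q) * Y\<^sup>2)
    + q ^ 3 * (theta (Q ^ 5) (- (Q ^ 3)) * (2 * X * Y)) - q ^ 4 * (theta (Q ^ 5) (- (Q ^ 3)) * Y\<^sup>2)"
proof -
  have q: "norm q < 1" "q \<noteq> 0"
    using p by (simp_all add: q_def norm_power power_less_one_iff)
  have P: "norm P < 1" "P \<noteq> 0" "Q = P\<^sup>2"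
    using p by (simp_all add: P_def Q_def q_def norm_power power_less_one_iff flip: power_mult)
  have Q: "norm Q < 1" "Q \<noteq> 0"
    using q by (simp_all add: Q_def norm_power power_less_one_iff)
  define T where "T = theta (Q ^ 5)"
  have T_inv: "T (inverse x) = T x" and T_inv': "T (- inverse x) = T (- x)" for x
    using theta_inverse[of "Q ^ 5" x] theta_inverse[of "Q ^ 5" "- x"] by (simp_all add: T_def)
  have T_shift: "T (Q ^ 10 / x) = T x * x / Q ^ 5" if "x \<noteq> 0" for x
    using theta_quasiperiod[of "Q ^ 5" "inverse x"] Q that
    by (simp add: T_def theta_inverse divide_inverse flip: power_mult)
  have cancel: "Q ^ 10 / Q ^ 3 = Q ^ 7" "Q ^ 10 / Q ^ 4 = Q ^ 6" "Q ^ 10 / 1 = Q ^ 10"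
    "x * Q ^ 3 / Q ^ 5 = x / Q\<^sup>2" "x * Q ^ 4 / Q ^ 5 = x / Q" "x * 1 / Q ^ 5 = x / Q ^ 5" for x
    using Q by (simp_all add: eval_nat_numeral)
  have T7: "T (Q ^ 7) = T (Q ^ 3) / Q\<^sup>2" and T6: "T (Q ^ 6) = T (Q ^ 4) / Q"
    and T10: "T (Q ^ 10) = T 1 / Q ^ 5"
    using T_shift[of "Q ^ 3"] T_shift[of "Q ^ 4"] T_shift[of 1] Q unfolding cancel by simp_all
  \<comment> \<open>This kills the class of exponents congruent to 1 modulo 5.\<close>
  have T5: "T (- (Q ^ 5)) = 0"
    using jacobi_triple_product[of "Q ^ 5" "- (Q ^ 5)"] Q
    by (simp add: T_def norm_power power_less_one_iff qpoch_inf_one_eq_0)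
  have "q ^ 14 = q ^ 4 * Q\<^sup>2" "q ^ 8 = q ^ 3 * Q" "q ^ 26 = q * Q ^ 5"
    by (simp_all add: Q_def flip: power_mult power_add power_Suc)
  hence qQ: "q ^ 14 * x / Q\<^sup>2 = q ^ 4 * x" "q ^ 8 * x / Q = q ^ 3 * x" "q ^ 26 * x / Q ^ 5 = q * x" for x
    using Q by simp_all
  have J: "{-2..2} = {0, 1, 2, -1, -2 :: int}" by auto
  have D1: "theta (q ^ 5) q * theta (q ^ 5) (- (q ^ 3)) =
    T (- Q) * T Q - q ^ 8 * (T (- (Q ^ 3)) * T (Q ^ 5)) - q\<^sup>2 * (T (- Q) * T (Q ^ 3))
      + q ^ 4 * (T (- (Q ^ 3)) * T (Q ^ 3))"
  proof -
    have "q\<^sup>2 * - (q ^ 3) = - Q" "(- (q ^ 3))\<^sup>2 / q = Q"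
      using q by (simp_all add: Q_def eval_nat_numeral)
    hence a: "Q powi (2 * j) * q\<^sup>2 * - (q ^ 3) = - (Q powi (2 * j + 1))"
      and b: "Q powi (4 * j) * (- (q ^ 3))\<^sup>2 / q = Q powi (4 * j + 1)" for j
      using Q by (simp_all only: mult.assoc times_divide_eq_right[symmetric]) (simp_all
        add: power_int_add)
    have c: "Q powi (j * j) * (- (q ^ 3)) powi j = (- 1) powi j * q powi (5 * (j * j) + 3 * j)" for j
      using q power_int_mult_distrib[of "- 1" "q ^ 3" j]
        by (simp add: Q_def power_int_add power_int_power)
    show ?thesis
      using theta_five_dissection[of "q ^ 5" q "- (q ^ 3)"] Q q
      unfolding Q_def[symmetric] T_def[symmetric] a b c J
      by (simp add: T5 T7 T6 T10 T_inv T_inv' qQ power_int_minus)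
  qed
  have D2: "theta (q ^ 5) (q ^ 4) * theta (q ^ 5) (- (q ^ 3)) =
    T (- Q) * T (Q\<^sup>2) - q\<^sup>2 * (T (- (Q ^ 3)) * T (Q\<^sup>2)) - q ^ 3 * (T (- Q) * T (Q ^ 4))
      + q * (T (- (Q ^ 3)) * T 1)"
  proof -
    have "(q ^ 4)\<^sup>2 * - inverse (q ^ 3) = - Q" "(- inverse (q ^ 3))\<^sup>2 / q ^ 4 = inverse (Q\<^sup>2)"
      using q by (simp_all add: Q_def eval_nat_numeral field_simps)
    hence a: "Q powi (2 * j) * (q ^ 4)\<^sup>2 * - inverse (q ^ 3) = - (Q powi (2 * j + 1))"
      and b: "Q powi (4 * j) * (- inverse (q ^ 3))\<^sup>2 / q ^ 4 = Q powi (4 * j - 2)" for j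
      using Q by (simp_all only: mult.assoc times_divide_eq_right[symmetric]) (simp_all
        add: power_int_add power_int_diff divide_inverse)
    have c: "Q powi (j * j) * (- inverse (q ^ 3)) powi j =
      (- 1) powi j * q powi (5 * (j * j) - 3 * j)" for j
      using q power_int_mult_distrib[of "- 1" "inverse (q ^ 3)" j]
      by (simp add: Q_def power_int_diff power_int_power power_int_inverse divide_inverse)
    \<comment> \<open>The argument \<open>- (q\<^sup>3)\<close> is inverted first; otherwise the new arguments would not be powers of \<open>Q\<close>.\<close>
    show ?thesis
      using theta_five_dissection[of "q ^ 5" "q ^ 4" "- inverse (q ^ 3)"] Q q theta_inverse[of "q ^
        5" "- (q ^ 3)"]
      unfolding Q_def[symmetric] T_def[symmetric] a b c J
      by (simp add: T5 T7 T6 T10 T_inv T_inv' qQ power_int_minus)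
  qed
  note sq = theta_square_identities[OF P, folded T_def X_def Y_def]
  have "(theta (p ^ 5) p)\<^sup>2 =
    theta (q ^ 5) q * theta (q ^ 5) 1 + q\<^sup>2 * (theta (q ^ 5) (q ^ 4) * theta (q ^ 5) (q ^ 5))"
  proof -
    have "(q ^ 5)\<^sup>2 * inverse (q ^ 4) = q ^ 6" "q ^ 5 * inverse (q ^ 4) = q"
      using q by (simp_all add: eval_nat_numeral field_simps)
    hence "theta (q ^ 5) (q ^ 6) = theta (q ^ 5) (q ^ 4) / q"
      using theta_quasiperiod[of "q ^ 5" "inverse (q ^ 4)"] q by (simp add: theta_inverse)
    moreover have "(p ^ 5)\<^sup>2 = q ^ 5" "q ^ 5 * p\<^sup>2 = q ^ 6" "p\<^sup>2 = q" "p ^ 5 * p * 1 = q ^ 3"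
      by (simp_all add: q_def flip: power_mult power_add power_Suc2)
    moreover have "norm (p ^ 5) < 1"
      using p by (simp add: norm_power power_less_one_iff)
    moreover have "q ^ 3 * x / q = q\<^sup>2 * x" for x
      using q by (simp add: eval_nat_numeral)
    ultimately show ?thesis
      using theta_parity_split[of "p ^ 5" p 1] p by (simp add: power2_eq_square[of "theta _ _"])
  qed
  hence "(theta (p ^ 5) p)\<^sup>2 * theta (q ^ 5) (- (q ^ 3)) =
     theta Q 1 * (theta (q ^ 5) q * theta (q ^ 5) (- (q ^ 3))) +
     q\<^sup>2 * theta Q Q * (theta (q ^ 5) (q ^ 4) * theta (q ^ 5) (- (q ^ 3)))"
    by (simp add: Q_def algebra_simps)
  also have "\<dots> = T (- Q) * (theta Q 1 * T Q - Q * (theta Q Q * T (Q ^ 4)))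
     + q\<^sup>2 * (T (- Q) * (theta Q Q * T (Q\<^sup>2) - theta Q 1 * T (Q ^ 3)))
     + q ^ 3 * (T (- (Q ^ 3)) * (theta Q Q * T 1 - Q * (theta Q 1 * T (Q ^ 5))))
     - q ^ 4 * (T (- (Q ^ 3)) * (theta Q Q * T (Q\<^sup>2) - theta Q 1 * T (Q ^ 3)))"
    unfolding D1 D2 Q_def by algebra
  finally show ?thesis
    unfolding sq by (simp add: T_def)
qed

text \<open>
  The closed form of \<open>H r\<close>. The value 0 for \<open>r = 1\<close> stands for the class of exponents that does
  not occur.
\<close>

definition G1_part :: "nat \<Rightarrow> complex \<Rightarrow> complex" where
  "G1_part r q =
    (if r = 0 then 1 / ((qpochs_inf [q, q ^ 4] (q ^ 5))\<^sup>2 * qpochs_inf [q ^ 2, q ^ 8] (q ^ 10))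
     else if r = 2 then 1 / ((qpochs_inf [q ^ 2, q ^ 3] (q ^ 5))\<^sup>2 * qpochs_inf [q ^ 2, q ^ 8] (q ^ 10))
     else if r = 3 then 2 / (qpochs_inf [q, q ^ 2, q ^ 3, q ^ 4] (q ^ 5) *
       qpochs_inf [q ^ 4, q ^ 6] (q ^ 10))
     else if r = 4 then - 1 / ((qpochs_inf [q ^ 2, q ^ 3] (q ^ 5))\<^sup>2 *
       qpochs_inf [q ^ 4, q ^ 6] (q ^ 10))
     else 0)"

lemma qpochs_inf_simps: "qpochs_inf [] q = 1" "qpochs_inf (a # as) q = qpoch_inf a q * qpochs_inf as q"
  by (simp_all add: qpochs_inf_def)

lemma qpoch_inf_0: "qpoch_inf 0 q = 1"
  by (simp add: qpoch_inf_def)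

text \<open>
  The numerator dissection divided by \<open>(Q; Q)\<^sub>\<infinity>\<^sup>2 (Q\<^sup>2; Q\<^sup>2)\<^sub>\<infinity>\<close>, where all theta series are
  replaced by their products. The case \<open>q = 0\<close> is separate because theta series require a
  nonzero base.
\<close>

lemma G1_dissection:
  assumes "norm q < 1"
  shows "G1 q = (\<Sum>r<5. q ^ r * G1_part r (q ^ 5))"
proof (cases "q = 0")
  case True
  thus ?thesis
    by (simp add: eval_nat_numeral G1_def G1_part_def qpochs_inf_simps qpoch_inf_0)
next
  case False
  define p where "p = csqrt q"
  have p_q: "p ^ 2 = q" by (simp add: p_def)
  have p: "norm p < 1" "p \<noteq> 0"
  proof -
    have "norm p ^ 2 < 1" unfolding norm_power[symmetric] p_q by fact
    thus "norm p < 1" by (simp add: power_less_one_iff)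
    show "p \<noteq> 0" using False p_q by auto
  qed
  define P where "P = p ^ 5"
  define Q where "Q = q ^ 5"
  have base: "norm (q ^ k) < 1" "norm (Q ^ k) < 1" if "k > 0" for k
    using assms that by (simp_all add: Q_def norm_power power_less_one_iff flip: power_mult)
  have P: "norm P < 1" "P \<noteq> 0" and Q: "norm Q < 1" "Q \<noteq> 0"
    using p assms False by (simp_all add: P_def Q_def norm_power power_less_one_iff)
  have pq: "p ^ 4 = q\<^sup>2" "p ^ 6 = q ^ 3" "p ^ 10 = q ^ 5"
    "P\<^sup>2 = Q" "P ^ 4 = Q\<^sup>2" "P ^ 6 = Q ^ 3" "P ^ 8 = Q ^ 4" "P ^ 10 = Q ^ 5" "q ^ 10 = Q\<^sup>2"
    unfolding Q_def P_def p_q[symmetric] by (simp_all flip: power_mult)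
  define u where "u = (\<lambda>k. qpoch_inf (Q ^ k) (Q ^ 5))"
  define w where "w = (\<lambda>k. qpoch_inf (Q ^ k) (Q ^ 10))"
  have nz: "u k \<noteq> 0" "w k \<noteq> 0" if "k > 0" for k
    unfolding u_def w_def using that qpoch_inf_nonzero[OF base(2) base(2)] by auto
  have split5: "qpoch_inf a s = qpoch_inf a (s ^ 5) * qpoch_inf (a * s) (s ^ 5) * qpoch_inf (a *
    s ^ 2) (s ^ 5)
      * qpoch_inf (a * s ^ 3) (s ^ 5) * qpoch_inf (a * s ^ 4) (s ^ 5)" if "norm s < 1" for a s
    using qpoch_inf_split[OF that, of 5 a] by (simp add: eval_nat_numeral(2,3) lessThan_Suc mult_ac)
  have D1: "qpoch_inf Q Q = u 1 * u 2 * u 3 * u 4 * u 5"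
    using split5[OF Q(1), of Q] by (simp add: u_def flip: power_Suc power2_eq_square)
  have D2: "qpoch_inf (Q\<^sup>2) (Q\<^sup>2) = w 2 * w 4 * w 6 * w 8 * w 10"
    using split5[OF base(2)[of 2], of "Q\<^sup>2"] by (simp add: w_def flip: power_mult power_add)
  have X: "theta (P ^ 5) (- P) = u 3 * u 2 * u 5"
    using theta_half_base_product[OF P, of 1] by (simp add: pq u_def)
  have Y: "theta (P ^ 5) (- (P ^ 3)) = u 4 * u 1 * u 5"
    using theta_half_base_product[OF P, of 3] by (simp add: pq u_def)
  have B: "theta (Q ^ 5) (- Q) = w 6 * w 4 * w 10" "theta (Q ^ 5) (- (Q ^ 3)) = w 8 * w 2 * w 10"
    using theta_product_nat(2)[OF Q, of 1 5] theta_product_nat(2)[OF Q, of 3 5] by (simp_all add: w_def)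
  have "theta (p ^ 5) p = qpoch_inf (- (q ^ 3)) (q ^ 5) * qpoch_inf (- (q ^ 2)) (q ^ 5) * qpoch_inf Q Q"
    using theta_product_nat(1)[OF p, of 1 5] by (simp add: pq Q_def)
  moreover have "theta (q ^ 5) (- (q ^ 3)) =
    qpoch_inf (q ^ 8) (q ^ 10) * qpoch_inf (q ^ 2) (q ^ 10) * qpoch_inf (Q\<^sup>2) (Q\<^sup>2)"
    using theta_product_nat(2)[OF assms False, of 3 5] by (simp add: pq(9)[symmetric])
  ultimately have "G1 q * ((qpoch_inf Q Q)\<^sup>2 * qpoch_inf (Q\<^sup>2) (Q\<^sup>2)) =
      (theta (p ^ 5) p)\<^sup>2 * theta (q ^ 5) (- (q ^ 3))"
    by (simp add: G1_def qpochs_inf_simps power_mult_distrib mult_ac)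
  also have "\<dots> = theta (Q ^ 5) (- Q) * (theta (P ^ 5) (- P))\<^sup>2
    + q\<^sup>2 * (theta (Q ^ 5) (- Q) * (theta (P ^ 5) (- (P ^ 3)))\<^sup>2)
    + q ^ 3 * (theta (Q ^ 5) (- (Q ^ 3)) * (2 * theta (P ^ 5) (- P) * theta (P ^ 5) (- (P ^ 3))))
    - q ^ 4 * (theta (Q ^ 5) (- (Q ^ 3)) * (theta (P ^ 5) (- (P ^ 3)))\<^sup>2)"
    using theta_numerator_dissection[OF p] unfolding p_q P_def Q_def .
  finally have *: "G1 q * ((qpoch_inf Q Q)\<^sup>2 * qpoch_inf (Q\<^sup>2) (Q\<^sup>2)) =
    w 6 * w 4 * w 10 * (u 3 * u 2 * u 5)\<^sup>2
    + q\<^sup>2 * (w 6 * w 4 * w 10 * (u 4 * u 1 * u 5)\<^sup>2)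
    + q ^ 3 * (w 8 * w 2 * w 10 * (2 * (u 3 * u 2 * u 5) * (u 4 * u 1 * u 5)))
    - q ^ 4 * (w 8 * w 2 * w 10 * (u 4 * u 1 * u 5)\<^sup>2)"
    unfolding X Y B .
  define D where "D = (qpoch_inf Q Q)\<^sup>2 * qpoch_inf (Q\<^sup>2) (Q\<^sup>2)"
  have D: "D = (u 1 * u 2 * u 3 * u 4 * u 5)\<^sup>2 * (w 2 * w 4 * w 6 * w 8 * w 10)"
    unfolding D_def D1 D2 ..
  have D0: "D \<noteq> 0"
    unfolding D using nz by simp
  have quotients:
    "w 6 * w 4 * w 10 * (u 3 * u 2 * u 5)\<^sup>2 / D = 1 / ((u 1 * u 4)\<^sup>2 * (w 2 * w 8))"
    "w 6 * w 4 * w 10 * (u 4 * u 1 * u 5)\<^sup>2 / D = 1 / ((u 2 * u 3)\<^sup>2 * (w 2 * w 8))"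
    "w 8 * w 2 * w 10 * (2 * (u 3 * u 2 * u 5) * (u 4 * u 1 * u 5)) / D =
      2 / ((u 1 * u 2 * u 3 * u 4) * (w 4 * w 6))"
    "w 8 * w 2 * w 10 * (u 4 * u 1 * u 5)\<^sup>2 / D = 1 / ((u 2 * u 3)\<^sup>2 * (w 4 * w 6))"
    subgoal by (subst frac_eq_eq) (use D0 nz in simp, use nz in simp, unfold D, algebra)
    subgoal by (subst frac_eq_eq) (use D0 nz in simp, use nz in simp, unfold D, algebra)
    subgoal by (subst frac_eq_eq) (use D0 nz in simp, use nz in simp, unfold D, algebra)
    subgoal by (subst frac_eq_eq) (use D0 nz in simp, use nz in simp, unfold D, algebra)
    done
  have "G1 q = G1 q * D / D"
    using D0 by simp
  also have "\<dots> = w 6 * w 4 * w 10 * (u 3 * u 2 * u 5)\<^sup>2 / D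
    + q\<^sup>2 * (w 6 * w 4 * w 10 * (u 4 * u 1 * u 5)\<^sup>2 / D)
    + q ^ 3 * (w 8 * w 2 * w 10 * (2 * (u 3 * u 2 * u 5) * (u 4 * u 1 * u 5)) / D)
    - q ^ 4 * (w 8 * w 2 * w 10 * (u 4 * u 1 * u 5)\<^sup>2 / D)"
    unfolding *[folded D_def]
      by (simp only: add_divide_distrib diff_divide_distrib times_divide_eq_right)
  also have "\<dots> = (\<Sum>r<5. q ^ r * G1_part r (q ^ 5))"
  proof -
    have "G1_part 0 Q = 1 / ((u 1 * u 4)\<^sup>2 * (w 2 * w 8))"
      "G1_part 1 Q = 0"
      "G1_part 2 Q = 1 / ((u 2 * u 3)\<^sup>2 * (w 2 * w 8))"
      "G1_part 3 Q = 2 / (u 1 * u 2 * u 3 * u 4 * (w 4 * w 6))"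
      "G1_part 4 Q = - (1 / ((u 2 * u 3)\<^sup>2 * (w 4 * w 6)))"
      by (simp_all add: G1_part_def qpochs_inf_simps u_def w_def mult.assoc)
    moreover have "(\<Sum>r<5. f r) = f 0 + f 1 + f 2 + f 3 + f 4" for f :: "nat \<Rightarrow> complex"
      by (simp add: eval_nat_numeral)
    ultimately show ?thesis
      unfolding quotients by (simp add: Q_def)
  qed
  finally show ?thesis .
qed

section \<open>Power series with integer coefficients\<close>

text \<open>
  On \<open>cball 0 R\<close> the \<open>n\<close>-th factor differs from 1 by at most \<open>norm c * R ^ n\<close>.
\<close>

lemma uniform_limit_qpoch:
  assumes R: "R < 1" and a: "a > 0" and b: "b > 0"
  shows "uniform_limit (cball 0 R) (\<lambda>N q. \<Prod>n<N. 1 - c * q ^ b * (q ^ a) ^ n)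
    (\<lambda>q. qpoch_inf (c * q ^ b) (q ^ a)) sequentially"
proof (cases "R \<ge> 0")
  case True
  let ?f = "\<lambda>n q :: complex. 1 - c * q ^ b * (q ^ a) ^ n"
  have bound: "norm (c * q ^ b * (q ^ a) ^ n) \<le> norm c * R ^ n" if "q \<in> cball 0 R" for q n
  proof -
    have q: "norm q \<le> R" using that by simp
    have "norm q ^ b \<le> 1"
      using q R by (intro power_le_one) auto
    moreover have "norm q ^ a \<le> norm q"
      using power_decreasing[of 1 a "norm q"] q R a by simp
    hence "(norm q ^ a) ^ n \<le> R ^ n"
      using q by (intro power_mono) auto
    ultimately have "norm q ^ b * (norm q ^ a) ^ n \<le> 1 * R ^ n"
      by (intro mult_mono) auto
    thus ?thesis
      unfolding norm_mult norm_power mult.assoc by (intro mult_left_mono) auto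
  qed
  have "uniformly_convergent_on (cball 0 R) (\<lambda>N q. \<Sum>n<N. norm (?f n q - 1))"
  proof (rule Weierstrass_m_test')
    show "norm (norm (?f n q - 1)) \<le> norm c * R ^ n" if "q \<in> cball 0 R" for n q
      using bound[OF that] by simp
    show "summable (\<lambda>n. norm c * R ^ n)"
      using R True by (intro summable_mult summable_geometric) auto
  qed
  hence "uniformly_convergent_on (cball 0 R) (\<lambda>N q. \<Prod>n<N. ?f n q)"
    by (intro uniformly_convergent_on_prod') (auto intro!: continuous_intros)
  hence "uniform_limit (cball 0 R) (\<lambda>N q. \<Prod>n<N. ?f n q) (\<lambda>q. lim (\<lambda>N. \<Prod>n<N. ?f n q)) sequentially"
    by (simp only: uniformly_convergent_uniform_limit_iff)
  moreover have "lim (\<lambda>N. \<Prod>n<N. ?f n q) = qpoch_inf (c * q ^ b) (q ^ a)" if "q \<in> cball 0 R" for q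
    using that R a by (intro limI qpoch_inf_tendsto) (simp add: norm_power power_less_one_iff)
  ultimately show ?thesis
    by (subst (asm) uniform_limit_cong'[where g = "\<lambda>N q. \<Prod>n<N. ?f n q"]) auto
qed auto

lemma qpoch_inf_holomorphic:
  assumes "a > 0" "b > 0"
  shows "(\<lambda>q. qpoch_inf (c * q ^ b) (q ^ a)) holomorphic_on ball 0 1"
proof (rule holomorphic_uniform_sequence)
  show "(\<lambda>q. \<Prod>n<N. 1 - c * q ^ b * (q ^ a) ^ n) holomorphic_on ball 0 1" for N
    by (intro holomorphic_intros)
  fix x :: complex assume x: "x \<in> ball 0 1"
  define d where "d = (1 - norm x) / 2"
  have sub: "cball x d \<subseteq> cball 0 (norm x + d)"
  proof
    fix y assume "y \<in> cball x d"
    thus "y \<in> cball 0 (norm x + d)"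
      using norm_triangle_sub[of y x] by (simp add: dist_norm norm_minus_commute)
  qed
  have d: "d > 0" "norm x + d < 1"
    using x by (auto simp: d_def field_simps)
  show "\<exists>d>0. cball x d \<subseteq> ball 0 1 \<and>
       uniform_limit (cball x d) (\<lambda>N q. \<Prod>n<N. 1 - c * q ^ b * (q ^ a) ^ n)
         (\<lambda>q. qpoch_inf (c * q ^ b) (q ^ a)) sequentially"
    using uniform_limit_on_subset[OF uniform_limit_qpoch[OF d(2) assms, of c] sub] sub d
    by (intro exI[of _ d]) auto
qed auto

definition integral_fps_expansion :: "(complex \<Rightarrow> complex) \<Rightarrow> bool" where
  "integral_fps_expansion f \<longleftrightarrow> (\<exists>F. f has_fps_expansion F \<and> (\<forall>n. fps_nth F n \<in> \<int>))"

lemma integral_fps_expansion_mult: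
  "integral_fps_expansion f \<Longrightarrow> integral_fps_expansion g \<Longrightarrow> integral_fps_expansion (\<lambda>q. f q * g q)"
  unfolding integral_fps_expansion_def
proof safe
  fix F G assume *: "f has_fps_expansion F" "g has_fps_expansion G" "\<forall>n. fps_nth F n \<in> \<int>" "\<forall>n.
    fps_nth G n \<in> \<int>"
  have "fps_nth (F * G) n \<in> \<int>" for n
    unfolding fps_mult_nth using * by (intro Ints_sum Ints_mult) auto
  thus "\<exists>H. (\<lambda>q. f q * g q) has_fps_expansion H \<and> (\<forall>n. fps_nth H n \<in> \<int>)"
    using has_fps_expansion_mult[OF *(1,2)] by blast
qed

lemma integral_fps_expansion_prod:
  "(\<And>i. i \<in> I \<Longrightarrow> integral_fps_expansion (f i)) \<Longrightarrow> integral_fps_expansion (\<lambda>q. \<Prod>i\<in>I. f i q)"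
proof (induction I rule: infinite_finite_induct)
  case (insert i I)
  thus ?case by (auto intro!: integral_fps_expansion_mult)
qed (auto simp: integral_fps_expansion_def intro!: exI[of _ "1 :: complex fps"])

text \<open>
  The partial products are polynomials with integer coefficients. They converge locally
  uniformly, so each Taylor coefficient of the infinite product is a limit of integers, and \<open>\<int>\<close>
  is closed.
\<close>

lemma integral_fps_expansion_qpoch:
  assumes "a > 0" "b > 0" "c \<in> \<int>"
  shows "integral_fps_expansion (\<lambda>q. qpoch_inf (c * q ^ b) (q ^ a))"
proof -
  let ?f = "\<lambda>q. qpoch_inf (c * q ^ b) (q ^ a)"
  let ?P = "\<lambda>N q. \<Prod>n<N. 1 - c * q ^ b * (q ^ a) ^ n"
  have P: "integral_fps_expansion (?P N)" for N
  proof (rule integral_fps_expansion_prod)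
    fix n
    have "(\<lambda>q. 1 - c * q ^ b * (q ^ a) ^ n) has_fps_expansion 1 - fps_const c * fps_X ^ b *
      (fps_X ^ a) ^ n"
      by (intro fps_expansion_intros)
    moreover have "fps_nth (1 - fps_const c * fps_X ^ b * (fps_X ^ a) ^ n) k \<in> \<int>" for k
    proof -
      have "1 - fps_const c * fps_X ^ b * (fps_X ^ a) ^ n = 1 - fps_const c * fps_X ^ (b + a * n)"
        by (simp only: power_add power_mult mult.assoc)
      thus ?thesis
        using assms(3) by (simp only:) simp
    qed
    ultimately show "integral_fps_expansion (\<lambda>q. 1 - c * q ^ b * (q ^ a) ^ n)"
      unfolding integral_fps_expansion_def by blast
  qed
  have exp: "?f has_fps_expansion fps_expansion ?f 0"
    using qpoch_inf_holomorphic[OF assms(1,2), of c]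
      by (intro has_fps_expansion_fps_expansion[of "ball 0 1"]) auto
  have "(deriv ^^ n) ?f 0 / fact n \<in> \<int>" for n
  proof (rule closed_sequentially[OF closed_Ints])
    show "(deriv ^^ n) (?P N) 0 / fact n \<in> \<int>" for N
    proof -
      obtain F where "?P N has_fps_expansion F" "fps_nth F n \<in> \<int>"
        using P[of N] unfolding integral_fps_expansion_def by blast
      thus ?thesis using fps_nth_fps_expansion[of "?P N" F n] by simp
    qed
    have "uniform_limit (ball 0 (1 / 2)) ?P ?f sequentially"
      by (rule uniform_limit_on_subset[OF uniform_limit_qpoch[of "1/2"]]) (use assms in auto)
    hence "(\<lambda>N. (deriv ^^ n) (?P N) 0) \<longlonglongrightarrow> (deriv ^^ n) ?f 0"
      by (rule higher_deriv_complex_uniform_limit) (auto intro!: holomorphic_intros always_eventually)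
    thus "(\<lambda>N. (deriv ^^ n) (?P N) 0 / fact n) \<longlonglongrightarrow> (deriv ^^ n) ?f 0 / fact n"
      by (intro tendsto_intros) auto
  qed
  thus ?thesis
    unfolding integral_fps_expansion_def using exp by (auto simp: fps_expansion_def)
qed

lemma power_series_coeff_unique:
  fixes a :: "nat \<Rightarrow> complex"
  assumes "\<And>q. norm q < 1 \<Longrightarrow> (\<lambda>n. a n * q ^ n) sums f q"
  shows "a n = (deriv ^^ n) f 0 / fact n"
proof -
  have "eventually (\<lambda>q. norm q < 1) (nhds (0 :: complex))"
    using eventually_nhds_in_open[of "ball 0 1" "0 :: complex"] by auto
  hence "f has_fps_expansion Abs_fps a"
    by (intro has_fps_expansionI) (auto elim!: eventually_mono assms)
  from fps_nth_fps_expansion[OF this, of n] show ?thesis by simp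
qed

section \<open>Comparison of coefficients\<close>

lemma G1_eq:
  "G1 q = (qpoch_inf (- (q ^ 2)) (q ^ 5) * qpoch_inf (- (q ^ 3)) (q ^ 5)) *
          (qpoch_inf (- (q ^ 2)) (q ^ 5) * qpoch_inf (- (q ^ 3)) (q ^ 5)) *
          (qpoch_inf (q ^ 2) (q ^ 10) * qpoch_inf (q ^ 8) (q ^ 10))"
  by (simp only: G1_def qpochs_inf_simps mult_1_right power2_eq_square[of "qpoch_inf _ _ * _"])

lemma integral_fps_expansion_G1: "integral_fps_expansion G1"
proof -
  have "integral_fps_expansion (\<lambda>q. qpoch_inf (- (q ^ 2)) (q ^ 5))"
    "integral_fps_expansion (\<lambda>q. qpoch_inf (- (q ^ 3)) (q ^ 5))"
    "integral_fps_expansion (\<lambda>q. qpoch_inf (q ^ 2) (q ^ 10))"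
    "integral_fps_expansion (\<lambda>q. qpoch_inf (q ^ 8) (q ^ 10))"
    using integral_fps_expansion_qpoch[of 5 2 "-1"] integral_fps_expansion_qpoch[of 5 3 "-1"]
      integral_fps_expansion_qpoch[of 10 2 1] integral_fps_expansion_qpoch[of 10 8 1]
    by simp_all
  thus ?thesis
    unfolding G1_eq[abs_def] by (intro integral_fps_expansion_mult)
qed

lemma qpoch_inf_powers_holomorphic:
  assumes "a > 0" "b > 0"
  shows "(\<lambda>q. qpoch_inf (q ^ b) (q ^ a)) holomorphic_on ball 0 1"
    and "(\<lambda>q. qpoch_inf (- (q ^ b)) (q ^ a)) holomorphic_on ball 0 1"
  using qpoch_inf_holomorphic[OF assms, of 1] qpoch_inf_holomorphic[OF assms, of "-1"] by simp_all

lemma qpoch_inf_powers_nonzero: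
  assumes "norm q < 1" "a > 0" "b > 0"
  shows "qpoch_inf (q ^ b) (q ^ a) \<noteq> 0"
  using assms by (intro qpoch_inf_nonzero) (simp_all add: norm_power power_less_one_iff)

lemma G1_holomorphic: "G1 holomorphic_on ball 0 1"
  unfolding G1_eq[abs_def]
  by (intro holomorphic_on_mult qpoch_inf_powers_holomorphic) simp_all

lemma G1_part_holomorphic: "G1_part r holomorphic_on ball 0 1"
proof -
  have hol: "(\<lambda>q. qpoch_inf q (q ^ 5)) holomorphic_on ball 0 1"
    using qpoch_inf_powers_holomorphic(1)[of 5 1] by simp
  have nz: "qpoch_inf q (q ^ 5) \<noteq> 0" if "norm q < 1" for q
    using qpoch_inf_powers_nonzero[of q 5 1] that by simp
  have hols: "(\<lambda>q. qpochs_inf [q, q ^ 4] (q ^ 5)) holomorphic_on ball 0 1"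
    "(\<lambda>q. qpochs_inf [q ^ 2, q ^ 3] (q ^ 5)) holomorphic_on ball 0 1"
    "(\<lambda>q. qpochs_inf [q, q ^ 2, q ^ 3, q ^ 4] (q ^ 5)) holomorphic_on ball 0 1"
    "(\<lambda>q. qpochs_inf [q ^ 2, q ^ 8] (q ^ 10)) holomorphic_on ball 0 1"
    "(\<lambda>q. qpochs_inf [q ^ 4, q ^ 6] (q ^ 10)) holomorphic_on ball 0 1"
    unfolding qpochs_inf_simps mult_1_right
    by (intro holomorphic_on_mult hol qpoch_inf_powers_holomorphic; simp)+
  have nzs: "qpochs_inf [q, q ^ 4] (q ^ 5) \<noteq> 0" "qpochs_inf [q ^ 2, q ^ 3] (q ^ 5) \<noteq> 0"
    "qpochs_inf [q, q ^ 2, q ^ 3, q ^ 4] (q ^ 5) \<noteq> 0"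
    "qpochs_inf [q ^ 2, q ^ 8] (q ^ 10) \<noteq> 0" "qpochs_inf [q ^ 4, q ^ 6] (q ^ 10) \<noteq> 0"
      if "norm q < 1" for q
    using nz[OF that] qpoch_inf_powers_nonzero[OF that] by (simp_all add: qpochs_inf_simps)
  consider "r = 0" | "r = 2" | "r = 3" | "r = 4" | "r \<notin> {0, 2, 3, 4}" by auto
  thus ?thesis
    by cases (auto simp: G1_part_def[abs_def] nzs intro!: holomorphic_on_divide holomorphic_on_mult
        holomorphic_on_power holomorphic_on_const holomorphic_on_minus hols)
qed

text \<open>
  The defining property of \<open>h1\<close>: the Taylor coefficients of \<open>G1\<close> are integers, and no other
  sequence represents \<open>G1\<close> on the disc.
\<close>

lemma h1_sums_G1:
  assumes "norm q < 1"
  shows "(\<lambda>n. of_int (h1 n) * q ^ n) sums G1 q"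
proof -
  define c where "c = (\<lambda>n. (deriv ^^ n) G1 0 / fact n)"
  have c_sums: "(\<lambda>n. c n * q ^ n) sums G1 q" if "norm q < 1" for q
    using holomorphic_power_series[OF G1_holomorphic, of q] that by (simp add: c_def)
  have "c n \<in> \<int>" for n
  proof -
    obtain F where "G1 has_fps_expansion F" "fps_nth F n \<in> \<int>"
      using integral_fps_expansion_G1 unfolding integral_fps_expansion_def by blast
    thus ?thesis using fps_nth_fps_expansion[of G1 F n] by (simp add: c_def)
  qed
  hence "\<forall>n. \<exists>k. c n = of_int k"
    by (auto elim: Ints_cases)
  then obtain h where h: "\<And>n. c n = of_int (h n)"
    by metis
  have "h1 = h"
    unfolding h1_def
  proof (rule the_equality)
    show "\<forall>q. norm q < 1 \<longrightarrow> (\<lambda>n. of_int (h n) * q ^ n) sums G1 q"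
      using c_sums h by simp
    fix h' :: "nat \<Rightarrow> int"
    assume "\<forall>q. norm q < 1 \<longrightarrow> (\<lambda>n. of_int (h' n) * q ^ n) sums G1 q"
    hence "of_int (h' n) = c n" for n
      unfolding c_def by (intro power_series_coeff_unique) auto
    thus "h' = h" using h by (intro ext) (metis of_int_eq_iff)
  qed
  thus ?thesis using c_sums[OF assms] h by simp
qed

text \<open>
  Interleaving the Taylor coefficients of the five functions \<open>G1_part r\<close> yields a power series
  which sums to \<open>G1\<close> by the dissection, so it is the Taylor series of \<open>G1\<close>.
\<close>

lemma h1_residue_sums:
  assumes r: "r < 5" and q: "norm q < 1"
  shows "(\<lambda>n. of_int (h1 (5 * n + r)) * q ^ n) sums G1_part r q"
proof -
  define e where "e = (\<lambda>r n. (deriv ^^ n) (G1_part r) 0 / fact n)"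
  have e_sums: "(\<lambda>n. e r n * q ^ n) sums G1_part r q" if "norm q < 1" for r q
    using holomorphic_power_series[OF G1_part_holomorphic, of q] that by (simp add: e_def)
  define a where "a = (\<lambda>n. e (n mod 5) (n div 5))"
  have "(\<lambda>n. a n * q ^ n) sums G1 q" if q: "norm q < 1" for q
  proof -
    have "(\<lambda>n. if n mod 5 = r then a n * q ^ n else 0) sums (q ^ r * G1_part r (q ^ 5))" if "r < 5" for r
    proof -
      have "norm (q ^ 5) < 1"
        using q by (simp add: norm_power power_less_one_iff)
      hence "(\<lambda>n. q ^ r * (e r n * (q ^ 5) ^ n)) sums (q ^ r * G1_part r (q ^ 5))"
        by (intro sums_mult e_sums)
      also have "(\<lambda>n. q ^ r * (e r n * (q ^ 5) ^ n)) =
         (\<lambda>n. (\<lambda>n. if n mod 5 = r then a n * q ^ n else 0) (5 * n + r))"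
        using that by (auto simp: a_def power_add power_mult)
      finally show ?thesis
      proof (subst (asm) sums_mono_reindex)
        show "strict_mono (\<lambda>n. 5 * n + r)" by (auto simp: strict_mono_def)
        fix n assume "n \<notin> range (\<lambda>n. 5 * n + r)"
        moreover have "n = 5 * (n div 5) + r" if "n mod 5 = r"
          using mult_div_mod_eq[of 5 n] that by simp
        ultimately show "(if n mod 5 = r then a n * q ^ n else 0) = 0"
          by (metis rangeI)
      qed
    qed
    hence "(\<lambda>n. \<Sum>r<5. if n mod 5 = r then a n * q ^ n else 0) sums (\<Sum>r<5. q ^ r * G1_part r (q ^ 5))"
      by (intro sums_sum) auto
    thus ?thesis
      unfolding G1_dissection[OF q] by simp
  qed
  hence "of_int (h1 n) = a n" for n
    using power_series_coeff_unique[of a G1 n] power_series_coeff_unique[of "\<lambda>n. of_int (h1 n)" G1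
      n] h1_sums_G1 by simp
  hence "of_int (h1 (5 * n + r)) = e r n" for n
    using r by (simp add: a_def)
  thus ?thesis using e_sums[OF q, of r] by simp
qed

theorem theorem1p2:
  fixes q :: complex
  assumes "norm q < 1"
  shows "(\<lambda>n. of_int (h1 n) * q ^ n) sums G1 q
    \<and> G1 q = H 0 (q ^ 5) + q ^ 2 * H 2 (q ^ 5) + q ^ 3 * H 3 (q ^ 5) + q ^ 4 * H 4 (q ^ 5)
    \<and> (\<lambda>n. of_int (h1 (5 * n)) * q ^ n) sums H 0 q
    \<and> H 0 q = 1 / ((qpochs_inf [q, q ^ 4] (q ^ 5))\<^sup>2 * qpochs_inf [q ^ 2, q ^ 8] (q ^ 10))
    \<and> (\<lambda>n. of_int (h1 (5 * n + 2)) * q ^ n) sums H 2 q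
    \<and> H 2 q = 1 / ((qpochs_inf [q ^ 2, q ^ 3] (q ^ 5))\<^sup>2 * qpochs_inf [q ^ 2, q ^ 8] (q ^ 10))
    \<and> (\<lambda>n. of_int (h1 (5 * n + 3)) * q ^ n) sums H 3 q
    \<and> H 3 q = 2 / (qpochs_inf [q, q ^ 2, q ^ 3, q ^ 4] (q ^ 5) * qpochs_inf [q ^ 4, q ^ 6] (q ^ 10))
    \<and> (\<lambda>n. of_int (h1 (5 * n + 4)) * q ^ n) sums H 4 q
    \<and> H 4 q = - 1 / ((qpochs_inf [q ^ 2, q ^ 3] (q ^ 5))\<^sup>2 * qpochs_inf [q ^ 4, q ^ 6] (q ^ 10))"
proof -
  have H: "H r z = G1_part r z" if "r < 5" "norm z < 1" for r z
    using h1_residue_sums[OF that] unfolding H_def by (rule sums_unique[symmetric])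
  have "norm (q ^ 5) < 1"
    using assms by (simp add: norm_power power_less_one_iff)
  moreover have "(\<Sum>r<5. f r) = f 0 + f 1 + f 2 + f 3 + f 4" for f :: "nat \<Rightarrow> complex"
    by (simp add: eval_nat_numeral)
  moreover have "G1_part 1 z = 0" for z
    by (simp add: G1_part_def)
  ultimately have "G1 q = H 0 (q ^ 5) + q ^ 2 * H 2 (q ^ 5) + q ^ 3 * H 3 (q ^ 5) + q ^ 4 * H 4 (q ^ 5)"
    using G1_dissection[OF assms] by (simp add: H)
  thus ?thesis
    using h1_sums_G1[OF assms] h1_residue_sums[OF _ assms, of 0] h1_residue_sums[OF _ assms, of 2]
      h1_residue_sums[OF _ assms, of 3] h1_residue_sums[OF _ assms, of 4] assms
    by (simp add: H) (simp add: G1_part_def)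
qed

end
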